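(* Let $(a_{i,j})_{i,j\ge 1}$ be real numbers such that $a_{i,j}=a_{j,i}\ge 0$ for all $i,j\ge 1$, and suppose there are $\gamma\in[0,1]$ and $A_\gamma>0$ with $a_{i,j}\le A_\gamma (ij)^\gamma$ for all $i,j\ge 1$. Let $b_{i,j;k}\ge 0$ ($1\le i\le j-1$, $j\ge 2$, $k\ge 1$) satisfy $$\sum_{i=1}^{j-1} i\, b_{i,j;k}=j,\qquad j\ge 2,\ k\ge 1,$$ and suppose there are constants $\beta_0,\beta_1\ge 0$ such that $$b_{s,i;j}\le \beta_0+\beta_1 b_{s,j;i},\qquad 1\le s\le i-1,\ j\ge i.$$ Let $w$ and $\hat w$ be solutions on $[0,+\infty)$ to the discrete collision-induced breakage equation with initial conditions $w(0)=w^{\rm in}\in Y_{1+\gamma}^+$ and $\hat w(0)=\hat w^{\rm in}\in Y_{1+\gamma}^+$, respectively, such that $$w\in L^\infty((0,T),Y_{1+\gamma}^+)\quad\text{and}\quad \hat w\in L^\infty((0,T),Y_{1+\gamma}^+)\quad\text{for each } T>0.$$ Then, for each $T\ge 0$, there is a positive constant $\kappa(T,\|w^{\rm in}\|_{1+\gamma},\|\hat w^{\rm in}\|_{1+\gamma})$ such that $$\sup_{t\in[0,T]}\|w(t)-\hat w(t)\|_1\le \kappa(T,\|w^{\rm in}\|_{1+\gamma},\|\hat w^{\rm in}\|_{1+\gamma})\,\|w^{\rm in}-\hat w^{\rm in}\|_1 .$$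
   Context: Function spaces. For $\gamma_0\ge 0$, $Y_{\gamma_0}$ is the Banach space of real sequences $y=(y_i)_{i\ge1}$ with $\|y\|_{\gamma_0}:=\sum_{i\ge 1} i^{\gamma_0}|y_i|<\infty$, and $Y_{\gamma_0}^+:=\{y\in Y_{\gamma_0}: y_i\ge 0 \text{ for all } i\ge 1\}$. Equation. The discrete collision-induced breakage equation is $$\frac{dw_i}{dt}=\sum_{j=i+1}^{\infty}\sum_{k=1}^{\infty} a_{j,k}\, b_{i,j;k}\, w_j w_k-\sum_{j=1}^{\infty}a_{i,j}w_iw_j,\qquad w_i(0)=w_i^{\rm in},\qquad i\ge 1.$$ Solution. Let $T\in(0,+\infty]$ and $w^{\rm in}\in Y_1^+$. A solution on $[0,T)$ is a sequence $w=(w_i)_{i\ge 1}$ of non-negative continuous functions such that for each $i\ge 1$ and $t\in(0,T)$: (1) $w_i\in \mathcal C([0,T))$, $\sum_{j=1}^\infty a_{i,j}w_j\in L^1(0,t)$, and $\sum_{j=i+1}^\infty\sum_{k=1}^\infty b_{i,j;k}a_{j,k}w_jw_k\in L^1(0,t)$; (2) $$w_i(t)=w_i^{\rm in}+\int_0^t\Big(\sum_{j=i+1}^{\infty}\sum_{k=1}^{\infty} b_{i,j;k}a_{j,k}w_j(\tau)w_k(\tau)-\sum_{j=1}^{\infty}a_{i,j}w_i(\tau)w_j(\tau)\Big)d\tau .$$ *)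

theory Defs
  imports "HOL-Analysis.Analysis"
begin

text \<open>Sequences \<open>(y\<^sub>i)\<close> with \<open>i \<ge> 1\<close> are functions \<^typ>\<open>nat \<Rightarrow> real\<close>; the value at index \<open>0\<close> is
  never used. Likewise \<open>b i j k\<close> stands for $b_{i,j;k}$ and matters only for \<open>1 \<le> i < j\<close>, \<open>1 \<le> k\<close>.\<close>

definition Y_space :: "real \<Rightarrow> (nat \<Rightarrow> real) set"
  where "Y_space \<gamma> = {y. (\<lambda>i. real i powr \<gamma> * \<bar>y i\<bar>) summable_on {1..}}"

definition Y_norm :: "real \<Rightarrow> (nat \<Rightarrow> real) \<Rightarrow> real"
  where "Y_norm \<gamma> y = (\<Sum>\<^sub>\<infinity>i\<in>{1..}. real i powr \<gamma> * \<bar>y i\<bar>)"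

definition Y_pos :: "real \<Rightarrow> (nat \<Rightarrow> real) set"
  where "Y_pos \<gamma> = {y \<in> Y_space \<gamma>. \<forall>i\<ge>1. 0 \<le> y i}"

text \<open>Bochner (strong) measurability into the Banach space \<open>Y_space \<gamma>\<close>: almost everywhere the
  limit, in \<open>Y_norm \<gamma>\<close>, of simple functions. Since \<open>Y_norm \<gamma>\<close> takes a default value outside
  \<open>Y_space \<gamma>\<close>, membership is required as well.\<close>

definition Y_strongly_measurable :: "real \<Rightarrow> real set \<Rightarrow> (real \<Rightarrow> nat \<Rightarrow> real) \<Rightarrow> bool"
  where "Y_strongly_measurable \<gamma> I f \<longleftrightarrow>
    (AE t in lebesgue_on I. f t \<in> Y_space \<gamma>) \<and>
    (\<exists>s :: nat \<Rightarrow> real \<Rightarrow> nat \<Rightarrow> real.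
      (\<forall>n. simple_function (lebesgue_on I) (s n) \<and> (\<forall>t\<in>I. s n t \<in> Y_space \<gamma>)) \<and>
      (AE t in lebesgue_on I. (\<lambda>n. Y_norm \<gamma> (s n t - f t)) \<longlonglongrightarrow> 0))"

definition Linf_Y_pos :: "real \<Rightarrow> real set \<Rightarrow> (real \<Rightarrow> nat \<Rightarrow> real) \<Rightarrow> bool"
  where "Linf_Y_pos \<gamma> I f \<longleftrightarrow>
    Y_strongly_measurable \<gamma> I f \<and>
    (AE t in lebesgue_on I. f t \<in> Y_pos \<gamma>) \<and>
    (\<exists>C. AE t in lebesgue_on I. Y_norm \<gamma> (f t) \<le> C)"

definition gain :: "(nat \<Rightarrow> nat \<Rightarrow> real) \<Rightarrow> (nat \<Rightarrow> nat \<Rightarrow> nat \<Rightarrow> real) \<Rightarrow> (nat \<Rightarrow> real) \<Rightarrow> nat \<Rightarrow> real"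
  where "gain a b y i = (\<Sum>\<^sub>\<infinity>j\<in>{i+1..}. \<Sum>\<^sub>\<infinity>k\<in>{1..}. b i j k * a j k * y j * y k)"

definition loss :: "(nat \<Rightarrow> nat \<Rightarrow> real) \<Rightarrow> (nat \<Rightarrow> real) \<Rightarrow> nat \<Rightarrow> real"
  where "loss a y i = (\<Sum>\<^sub>\<infinity>j\<in>{1..}. a i j * y i * y j)"

text \<open>\<open>\<Sum>\<^sub>\<infinity>\<close> is \<open>0\<close> for a divergent series, so belonging to $L^1(0,t)$ has to include almost everywhere
  convergence of the series explicitly. All terms of the double series are non-negative, so its
  convergence as an iterated series is the same as summability over pairs \<open>(j, k)\<close>.\<close>

definition cib_solution ::
  "(nat \<Rightarrow> nat \<Rightarrow> real) \<Rightarrow> (nat \<Rightarrow> nat \<Rightarrow> nat \<Rightarrow> real) \<Rightarrow> ereal \<Rightarrow>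
    (nat \<Rightarrow> real) \<Rightarrow> (real \<Rightarrow> nat \<Rightarrow> real) \<Rightarrow> bool"
  where "cib_solution a b T w_in w \<longleftrightarrow>
    0 < T \<and> w_in \<in> Y_pos 1 \<and>
    (\<forall>i\<ge>1.
      (\<forall>t. 0 \<le> t \<and> ereal t < T \<longrightarrow> 0 \<le> w t i) \<and>
      continuous_on {t. 0 \<le> t \<and> ereal t < T} (\<lambda>t. w t i) \<and>
      (\<forall>t. 0 < t \<and> ereal t < T \<longrightarrow>
        (AE \<tau> in lebesgue_on {0<..<t}. (\<lambda>j. a i j * w \<tau> j) summable_on {1..}) \<and>
        integrable (lebesgue_on {0<..<t}) (\<lambda>\<tau>. \<Sum>\<^sub>\<infinity>j\<in>{1..}. a i j * w \<tau> j) \<and>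
        (AE \<tau> in lebesgue_on {0<..<t}.
          (\<lambda>(j, k). b i j k * a j k * w \<tau> j * w \<tau> k) summable_on ({i+1..} \<times> {1..})) \<and>
        integrable (lebesgue_on {0<..<t}) (\<lambda>\<tau>. gain a b (w \<tau>) i) \<and>
        w t i = w_in i + (\<integral>\<tau>. gain a b (w \<tau>) i - loss a (w \<tau>) i \<partial>lebesgue_on {0<..<t})))"

end

theory Submission
  imports Defs
begin

text \<open>
  If \<open>\<psi>\<close> is nondecreasing, a particle cannot increase \<open>\<Sum> i \<psi>\<^sub>i\<close> by breaking, so \<open>\<Sum> i \<psi>\<^sub>i w\<^sub>i(t)\<close> does
  not exceed its initial value. With \<open>\<psi>\<^sub>i = i\<^sup>\<gamma>\<close> for \<open>i > m\<close> and \<open>0\<close> otherwise, every tail of the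
  \<open>(1 + \<gamma>)\<close>-moment of a solution is dominated by that of its initial datum, uniformly in time.
  Hence all series in the equation converge uniformly and each \<open>w\<^sub>i\<close> is continuously differentiable.

  Put \<open>u = w - v\<close> and split \<open>w\<^sub>jw\<^sub>k - v\<^sub>jv\<^sub>k = u\<^sub>jw\<^sub>k + v\<^sub>ju\<^sub>k\<close>. In the derivative of \<open>\<Sum> i \<bar>u\<^sub>i\<bar>\<close>, mass
  conservation bounds the gain produced by \<open>u\<^sub>jw\<^sub>k\<close> by its loss; the terms with \<open>v\<^sub>ju\<^sub>k\<close> contribute at
  most \<open>2 A \<parallel>v\<parallel>\<^sub>1\<^sub>+\<^sub>\<gamma> \<parallel>u\<parallel>\<^sub>1\<close>, since \<open>a\<^sub>j\<^sub>k \<le> A (jk)\<^sup>\<gamma>\<close> and \<open>k\<^sup>\<gamma> \<le> k\<close>. Gronwall's inequality gives the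
  constant \<open>exp (2 A \<parallel>v\<^sub>i\<^sub>n\<parallel>\<^sub>1\<^sub>+\<^sub>\<gamma> T)\<close>.
\<close>

subsection \<open>Weighted sequence spaces\<close>

text \<open>The indices up to \<open>M\<close> stay, with value 0, so the tail of a norm is itself a
  \<open>Y_norm\<close> and the lemmas on sequence spaces apply to it unchanged.\<close>

definition seq_tail :: "nat \<Rightarrow> (nat \<Rightarrow> real) \<Rightarrow> nat \<Rightarrow> real"
  where "seq_tail M y = (\<lambda>j. if M < j then y j else 0)"

lemma seq_tail_0 [simp]: "1 \<le> i \<Longrightarrow> seq_tail 0 y i = y i"
  by (simp add: seq_tail_def)

lemma Y_space_mono:
  assumes "z \<in> Y_space p" "\<And>i. 1 \<le> i \<Longrightarrow> \<bar>y i\<bar> \<le> \<bar>z i\<bar>"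
  shows "y \<in> Y_space p" "Y_norm p y \<le> Y_norm p z"
proof -
  have z: "(\<lambda>i. real i powr p * \<bar>z i\<bar>) summable_on {1..}"
    using assms(1) by (simp add: Y_space_def)
  have y: "(\<lambda>i. real i powr p * \<bar>y i\<bar>) summable_on {1..}"
    by (rule summable_on_comparison_test[OF z]) (use assms(2) in \<open>auto intro!: mult_left_mono\<close>)
  then show "y \<in> Y_space p"
    by (simp add: Y_space_def)
  show "Y_norm p y \<le> Y_norm p z"
    unfolding Y_norm_def
    by (rule infsum_mono[OF y z]) (use assms(2) in \<open>auto intro!: mult_left_mono\<close>)
qed

lemma Y_space_exponent_mono:
  assumes "y \<in> Y_space q" "p \<le> q"
  shows "y \<in> Y_space p" "Y_norm p y \<le> Y_norm q y"
proof -
  have z: "(\<lambda>i. real i powr q * \<bar>y i\<bar>) summable_on {1..}"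
    using assms(1) by (simp add: Y_space_def)
  have le: "real i powr p * \<bar>y i\<bar> \<le> real i powr q * \<bar>y i\<bar>" if "1 \<le> i" for i
    using that assms(2) by (intro mult_right_mono powr_mono) auto
  have y: "(\<lambda>i. real i powr p * \<bar>y i\<bar>) summable_on {1..}"
    by (rule summable_on_comparison_test[OF z]) (use le in auto)
  then show "y \<in> Y_space p"
    by (simp add: Y_space_def)
  show "Y_norm p y \<le> Y_norm q y"
    unfolding Y_norm_def by (rule infsum_mono[OF y z]) (use le in auto)
qed

lemma Y_norm_nonneg: "0 \<le> Y_norm p y"
  unfolding Y_norm_def by (rule infsum_nonneg) auto

lemma Y_space_diff:
  assumes "y \<in> Y_space p" "z \<in> Y_space p"
  shows "y - z \<in> Y_space p" "Y_norm p (y - z) \<le> Y_norm p y + Y_norm p z"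
proof -
  have y: "(\<lambda>i. real i powr p * \<bar>y i\<bar>) summable_on {1..}"
    and z: "(\<lambda>i. real i powr p * \<bar>z i\<bar>) summable_on {1..}"
    using assms by (simp_all add: Y_space_def)
  have s: "(\<lambda>i. real i powr p * \<bar>y i\<bar> + real i powr p * \<bar>z i\<bar>) summable_on {1..}"
    by (intro summable_on_add y z)
  have le: "real i powr p * \<bar>(y - z) i\<bar> \<le> real i powr p * \<bar>y i\<bar> + real i powr p * \<bar>z i\<bar>" for i
    by (simp flip: distrib_left add: mult_left_mono)
  have d: "(\<lambda>i. real i powr p * \<bar>(y - z) i\<bar>) summable_on {1..}"
    by (rule summable_on_comparison_test[OF s]) (use le in auto)
  then show "y - z \<in> Y_space p"
    by (simp add: Y_space_def)
  have "Y_norm p (y - z) \<le> (\<Sum>\<^sub>\<infinity>i\<in>{1..}. real i powr p * \<bar>y i\<bar> + real i powr p * \<bar>z i\<bar>)"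
    unfolding Y_norm_def by (rule infsum_mono[OF d s]) (use le in auto)
  also have "\<dots> = Y_norm p y + Y_norm p z"
    unfolding Y_norm_def by (rule infsum_add[OF y z])
  finally show "Y_norm p (y - z) \<le> Y_norm p y + Y_norm p z" .
qed

lemma sum_le_Y_norm:
  assumes "y \<in> Y_space p"
  shows "(\<Sum>i=1..n. real i powr p * \<bar>y i\<bar>) \<le> Y_norm p y"
  unfolding Y_norm_def
  by (rule finite_sum_le_infsum) (use assms in \<open>auto simp: Y_space_def\<close>)

text \<open>Every finite set of positive indices lies in an initial segment and the terms are
  nonnegative, so bounds on initial segments suffice for summability and for the norm.\<close>

lemma Y_space_bounded_sums:
  assumes "\<And>n. (\<Sum>i=1..n. real i powr p * \<bar>y i\<bar>) \<le> K"
  shows "y \<in> Y_space p" "Y_norm p y \<le> K"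
proof -
  have fin: "(\<Sum>i\<in>F. real i powr p * \<bar>y i\<bar>) \<le> K" if "finite F" "F \<subseteq> {1..}" for F
  proof -
    \<comment> \<open>Inserting 0 makes \<open>Max\<close> meaningful for empty
      \<open>F\<close>.\<close>
    have "F \<subseteq> {1..Max (insert 0 F)}"
      using that by (auto intro: Max_ge)
    then have "(\<Sum>i\<in>F. real i powr p * \<bar>y i\<bar>) \<le> (\<Sum>i=1..Max (insert 0 F). real i powr p * \<bar>y i\<bar>)"
      by (intro sum_mono2) auto
    with assms show ?thesis
      by (meson order_trans)
  qed
  have "(\<lambda>i. real i powr p * \<bar>y i\<bar>) summable_on {1..}"
    by (rule nonneg_bdd_above_summable_on) (auto intro!: bdd_aboveI2[where M = K] fin)
  then show "y \<in> Y_space p" "Y_norm p y \<le> K"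
    unfolding Y_norm_def using fin by (auto simp: Y_space_def intro!: infsum_le_finite_sums)
qed

lemma seq_tail_Y_space:
  assumes "y \<in> Y_space p"
  shows "seq_tail M y \<in> Y_space p" "Y_norm p (seq_tail M y) \<le> Y_norm p y"
  using Y_space_mono[OF assms, of "seq_tail M y"] by (auto simp: seq_tail_def)

lemma Y_norm_split:
  assumes "y \<in> Y_space p"
  shows "Y_norm p y = (\<Sum>i=1..M. real i powr p * \<bar>y i\<bar>) + Y_norm p (seq_tail M y)"
proof -
  have *: "(\<lambda>i. real i powr p * \<bar>y i\<bar>) summable_on {1..}"
    using assms by (simp add: Y_space_def)
  have "{1..} = {1..M} \<union> {M<..}"
    by auto
  then have "Y_norm p y = (\<Sum>\<^sub>\<infinity>i\<in>{1..M} \<union> {M<..}. real i powr p * \<bar>y i\<bar>)"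
    unfolding Y_norm_def by metis
  also have "\<dots> = (\<Sum>\<^sub>\<infinity>i\<in>{1..M}. real i powr p * \<bar>y i\<bar>) + (\<Sum>\<^sub>\<infinity>i\<in>{M<..}. real i powr p * \<bar>y i\<bar>)"
    by (rule infsum_Un_disjoint) (auto intro: summable_on_subset_banach[OF *])
  also have "(\<Sum>\<^sub>\<infinity>i\<in>{M<..}. real i powr p * \<bar>y i\<bar>) = Y_norm p (seq_tail M y)"
    unfolding Y_norm_def by (rule infsum_cong_neutral) (auto simp: seq_tail_def)
  finally show ?thesis
    by simp
qed

lemma seq_tail_tendsto_0:
  assumes "y \<in> Y_space p"
  shows "(\<lambda>M. Y_norm p (seq_tail M y)) \<longlonglongrightarrow> 0"
proof -
  \<comment> \<open>Extension by 0 to index 0 turns the unordered sum over \<open>{1..}\<close> into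
    an ordinary series. Its partial sums are the norm minus the tails.\<close>
  have "((\<lambda>i. if 1 \<le> i then real i powr p * \<bar>y i\<bar> else 0) has_sum Y_norm p y) UNIV"
    unfolding Y_norm_def using assms
    by (subst has_sum_cong_neutral[where T = UNIV and S = "{1..}" and f = "\<lambda>i. real i powr p * \<bar>y i\<bar>", symmetric])
      (auto simp: Y_space_def)
  then have "(\<lambda>M. \<Sum>i<Suc M. if 1 \<le> i then real i powr p * \<bar>y i\<bar> else 0) \<longlonglongrightarrow> Y_norm p y"
    by (intro LIMSEQ_Suc) (use has_sum_imp_sums sums_def in blast)
  also have "(\<lambda>M. \<Sum>i<Suc M. if 1 \<le> i then real i powr p * \<bar>y i\<bar> else 0)
      = (\<lambda>M. Y_norm p y - Y_norm p (seq_tail M y))"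
  proof
    fix M
    have "(\<Sum>i<Suc M. if 1 \<le> i then real i powr p * \<bar>y i\<bar> else 0) = (\<Sum>i=1..M. real i powr p * \<bar>y i\<bar>)"
      by (rule sum.mono_neutral_cong_right) auto
    with Y_norm_split[OF assms, of M]
    show "(\<Sum>i<Suc M. if 1 \<le> i then real i powr p * \<bar>y i\<bar> else 0) = Y_norm p y - Y_norm p (seq_tail M y)"
      by simp
  qed
  finally have "(\<lambda>M. Y_norm p y - (Y_norm p y - Y_norm p (seq_tail M y))) \<longlonglongrightarrow> Y_norm p y - Y_norm p y"
    by (intro tendsto_diff tendsto_const)
  then show ?thesis
    by simp
qed

section \<open>Double series and term-by-term continuity\<close>

lemma has_sum_diff:
  fixes f g :: "'a \<Rightarrow> real"
  assumes "(f has_sum x) S" "(g has_sum y) S"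
  shows "((\<lambda>i. f i - g i) has_sum x - y) S"
  using has_sum_add[OF assms(1) has_sum_uminusI[OF assms(2)]] by simp

lemma has_sum_sum:
  fixes f :: "'i \<Rightarrow> 'a \<Rightarrow> real"
  assumes "finite I" "\<And>i. i \<in> I \<Longrightarrow> (f i has_sum s i) S"
  shows "((\<lambda>x. \<Sum>i\<in>I. f i x) has_sum (\<Sum>i\<in>I. s i)) S"
  using assms by (induction I rule: finite_induct) (auto intro: has_sum_add)

text \<open>Tonelli for the product majorant, whose iterated sums are explicit. Separate exponents
  \<open>p\<close> and \<open>q\<close> let one factor carry more weight than the other.\<close>

lemma bilinear_sum:
  assumes "y \<in> Y_space p" "z \<in> Y_space q" "0 \<le> C"
    and c: "\<And>j k. 1 \<le> j \<Longrightarrow> 1 \<le> k \<Longrightarrow> \<bar>c j k\<bar> \<le> C * real j powr p * real k powr q"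
  shows "(\<lambda>(j, k). c j k * y j * z k) summable_on {1..} \<times> {1..}"
    and "\<bar>\<Sum>\<^sub>\<infinity>(j, k)\<in>{1..} \<times> {1..}. c j k * y j * z k\<bar> \<le> C * Y_norm p y * Y_norm q z"
proof -
  have y: "((\<lambda>i. real i powr p * \<bar>y i\<bar>) has_sum Y_norm p y) {1..}"
    and z: "((\<lambda>i. real i powr q * \<bar>z i\<bar>) has_sum Y_norm q z) {1..}"
    using assms by (auto simp: Y_space_def Y_norm_def)
  let ?g = "\<lambda>(j, k). C * (real j powr p * \<bar>y j\<bar>) * (real k powr q * \<bar>z k\<bar>)"
  have 1: "((\<lambda>k. ?g (j, k)) has_sum C * (real j powr p * \<bar>y j\<bar>) * Y_norm q z) {1..}" for j
    using has_sum_cmult_right[OF z, of "C * (real j powr p * \<bar>y j\<bar>)"] by simp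
  have 2: "((\<lambda>j. C * (real j powr p * \<bar>y j\<bar>) * Y_norm q z) has_sum C * Y_norm p y * Y_norm q z) {1..}"
    by (intro has_sum_cmult_left has_sum_cmult_right y)
  have "?g summable_on {1..} \<times> {1..}"
    by (rule summable_on_SigmaI[OF 1 has_sum_imp_summable[OF 2]]) (use \<open>0 \<le> C\<close> in auto)
  then have g: "(?g has_sum C * Y_norm p y * Y_norm q z) ({1..} \<times> {1..})"
    by (rule has_sum_SigmaI[OF 1 2])
  have le: "norm (case x of (j, k) \<Rightarrow> c j k * y j * z k) \<le> ?g x" if "x \<in> {1..} \<times> {1..}" for x
  proof -
    obtain j k where [simp]: "x = (j, k)" and jk: "1 \<le> j" "1 \<le> k"
      using \<open>x \<in> {1..} \<times> {1..}\<close> by (cases x) auto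
    have "\<bar>c j k\<bar> * (\<bar>y j\<bar> * \<bar>z k\<bar>) \<le> C * real j powr p * real k powr q * (\<bar>y j\<bar> * \<bar>z k\<bar>)"
      using c[OF jk] by (intro mult_right_mono) auto
    then show ?thesis
      by (simp add: abs_mult mult_ac)
  qed
  have s: "(\<lambda>x. norm (case x of (j, k) \<Rightarrow> c j k * y j * z k)) summable_on {1..} \<times> {1..}"
    by (rule Infinite_Sum.abs_summable_on_comparison_test'[OF has_sum_imp_summable[OF g]]) (use le in auto)
  then show "(\<lambda>(j, k). c j k * y j * z k) summable_on {1..} \<times> {1..}"
    using summable_on_iff_abs_summable_on_real by blast
  have "\<bar>\<Sum>\<^sub>\<infinity>x\<in>{1..} \<times> {1..}. case x of (j, k) \<Rightarrow> c j k * y j * z k\<bar> \<le> infsum ?g ({1..} \<times> {1..})"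
    using norm_infsum_bound[OF s] infsum_mono[OF s has_sum_imp_summable[OF g] le] by simp
  then show "\<bar>\<Sum>\<^sub>\<infinity>(j, k)\<in>{1..} \<times> {1..}. c j k * y j * z k\<bar> \<le> C * Y_norm p y * Y_norm q z"
    using infsumI[OF g] by simp
qed

lemma dominated_infsum:
  assumes y: "y \<in> Y_space p" and "0 \<le> C"
    and g: "\<And>j. 1 \<le> j \<Longrightarrow> \<bar>g j\<bar> \<le> C * (real j powr p * \<bar>y j\<bar>)"
  shows "g summable_on {1..}" and "\<bar>infsum g {1..}\<bar> \<le> C * Y_norm p y"
proof -
  have h: "((\<lambda>j. C * (real j powr p * \<bar>y j\<bar>)) has_sum C * Y_norm p y) {1..}"
    unfolding Y_norm_def using y by (intro has_sum_cmult_right) (auto simp: Y_space_def)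
  have n: "(\<lambda>j. norm (g j)) summable_on {1..}"
    by (rule Infinite_Sum.abs_summable_on_comparison_test'[OF has_sum_imp_summable[OF h]]) (use g in auto)
  then show "g summable_on {1..}"
    using summable_on_iff_abs_summable_on_real by blast
  have "norm (infsum g {1..}) \<le> infsum (\<lambda>j. norm (g j)) {1..}"
    by (rule norm_infsum_bound[OF n])
  also have "\<dots> \<le> (\<Sum>\<^sub>\<infinity>j\<in>{1..}. C * (real j powr p * \<bar>y j\<bar>))"
    by (rule infsum_mono[OF n has_sum_imp_summable[OF h]]) (use g in auto)
  finally show "\<bar>infsum g {1..}\<bar> \<le> C * Y_norm p y"
    using infsumI[OF h] by simp
qed

lemma infsum_split_tail:
  assumes "g summable_on {1..}"
  shows "infsum g {1..} = (\<Sum>j=1..N. g j) + infsum (seq_tail N g) {1..}"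
proof -
  have "{1..} = {1..N} \<union> {N<..}"
    by auto
  then have "infsum g {1..} = infsum g ({1..N} \<union> {N<..})"
    by metis
  also have "\<dots> = infsum g {1..N} + infsum g {N<..}"
    by (rule infsum_Un_disjoint) (auto intro: summable_on_subset_banach[OF assms])
  also have "infsum g {N<..} = infsum (seq_tail N g) {1..}"
    by (rule infsum_cong_neutral) (auto simp: seq_tail_def)
  finally show ?thesis
    by simp
qed

text \<open>The Weierstrass argument: the remainder after \<open>N\<close> terms is at most
  \<open>C\<close> times the tail of the fixed sequence \<open>y\<close>, which does not depend on
  \<open>t\<close> and tends to 0, so the continuous partial sums converge uniformly.\<close>

lemma continuous_on_infsum_uniform_tail:
  fixes f :: "nat \<Rightarrow> real \<Rightarrow> real"
  assumes y: "y \<in> Y_space p" and w: "\<And>t. t \<in> S \<Longrightarrow> w t \<in> Y_space p"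
    and tail: "\<And>t N. t \<in> S \<Longrightarrow> Y_norm p (seq_tail N (w t)) \<le> Y_norm p (seq_tail N y)"
    and "0 \<le> C"
    and f: "\<And>j t. 1 \<le> j \<Longrightarrow> t \<in> S \<Longrightarrow> \<bar>f j t\<bar> \<le> C * (real j powr p * \<bar>w t j\<bar>)"
    and cont: "\<And>j. 1 \<le> j \<Longrightarrow> continuous_on S (f j)"
  shows "continuous_on S (\<lambda>t. \<Sum>\<^sub>\<infinity>j\<in>{1..}. f j t)"
proof (rule uniform_limit_theorem[where F = sequentially])
  show "\<forall>\<^sub>F N in sequentially. continuous_on S (\<lambda>t. \<Sum>j=1..N. f j t)"
    by (intro always_eventually allI continuous_on_sum cont) auto
  have le: "dist (\<Sum>j=1..N. f j t) (\<Sum>\<^sub>\<infinity>j\<in>{1..}. f j t) \<le> C * Y_norm p (seq_tail N y)" if t: "t \<in> S" for t N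
  proof -
    have s: "(\<lambda>j. f j t) summable_on {1..}"
      by (rule dominated_infsum(1)[OF w[OF t] \<open>0 \<le> C\<close>]) (use f t in auto)
    have "\<bar>infsum (seq_tail N (\<lambda>j. f j t)) {1..}\<bar> \<le> C * Y_norm p (seq_tail N (w t))"
      by (rule dominated_infsum(2)[OF seq_tail_Y_space(1)[OF w[OF t]] \<open>0 \<le> C\<close>])
        (use f t in \<open>auto simp: seq_tail_def\<close>)
    also have "\<dots> \<le> C * Y_norm p (seq_tail N y)"
      using tail[OF t] \<open>0 \<le> C\<close> by (rule mult_left_mono)
    finally show ?thesis
      using infsum_split_tail[OF s, of N] by (simp add: dist_real_def)
  qed
  have lim: "(\<lambda>N. C * Y_norm p (seq_tail N y)) \<longlonglongrightarrow> 0"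
    using tendsto_mult_right_zero[OF seq_tail_tendsto_0[OF y]] by blast
  show "uniform_limit S (\<lambda>N t. \<Sum>j=1..N. f j t) (\<lambda>t. \<Sum>\<^sub>\<infinity>j\<in>{1..}. f j t) sequentially"
    unfolding uniform_limit_iff
  proof (intro allI impI)
    fix e :: real assume "0 < e"
    have "\<forall>\<^sub>F N in sequentially. C * Y_norm p (seq_tail N y) < e"
      by (rule order_tendstoD(2)[OF lim \<open>0 < e\<close>])
    then show "\<forall>\<^sub>F N in sequentially. \<forall>t\<in>S. dist (\<Sum>j=1..N. f j t) (\<Sum>\<^sub>\<infinity>j\<in>{1..}. f j t) < e"
      by eventually_elim (use le in \<open>blast intro: le_less_trans\<close>)
  qed
qed simp

subsection \<open>Weak formulation and moment estimates\<close>

locale breakage_kernel =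
  fixes a :: "nat \<Rightarrow> nat \<Rightarrow> real" and b :: "nat \<Rightarrow> nat \<Rightarrow> nat \<Rightarrow> real" and \<gamma> A :: real
  assumes a_nonneg: "\<And>i j. 1 \<le> i \<Longrightarrow> 1 \<le> j \<Longrightarrow> 0 \<le> a i j"
    and gamma: "0 \<le> \<gamma>" "\<gamma> \<le> 1"
    and A_pos: "0 < A"
    and a_bound: "\<And>i j. 1 \<le> i \<Longrightarrow> 1 \<le> j \<Longrightarrow> a i j \<le> A * (real i * real j) powr \<gamma>"
    and b_nonneg: "\<And>i j k. 1 \<le> i \<Longrightarrow> i \<le> j - 1 \<Longrightarrow> 2 \<le> j \<Longrightarrow> 1 \<le> k \<Longrightarrow> 0 \<le> b i j k"
    and b_mass: "\<And>j k. 2 \<le> j \<Longrightarrow> 1 \<le> k \<Longrightarrow> (\<Sum>i=1..j-1. real i * b i j k) = real j"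
begin

text \<open>Net change in the number of particles of size \<open>i\<close> when a particle of size
  \<open>j\<close> is hit by one of size \<open>k\<close>. Only the fate of the first particle is
  counted; that of its partner belongs to the ordered pair \<open>(k, j)\<close>.\<close>

definition kern :: "nat \<Rightarrow> nat \<Rightarrow> nat \<Rightarrow> real"
  where "kern i j k = (if i < j then b i j k else 0) - (if i = j then 1 else 0)"

definition net :: "(nat \<Rightarrow> real) \<Rightarrow> nat \<Rightarrow> real"
  where "net y i = gain a b y i - loss a y i"

text \<open>The fragments of a particle of size \<open>j\<close> have total mass at most
  \<open>j\<close>, so a weight of at most \<open>m\<close> per unit of mass sums to at most
  \<open>m * j\<close>. After taking absolute values, the truncation at \<open>N\<close> only drops
  nonnegative terms.\<close>

lemma weighted_fragments_bound:
  assumes "1 \<le> j" "1 \<le> k" "0 \<le> m"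
    and p: "\<And>i. 1 \<le> i \<Longrightarrow> i \<le> N \<Longrightarrow> i < j \<Longrightarrow> \<bar>p i\<bar> \<le> real i * m"
  shows "\<bar>\<Sum>i=1..N. p i * (if i < j then b i j k else 0)\<bar> \<le> m * real j"
proof -
  have "\<bar>\<Sum>i=1..N. p i * (if i < j then b i j k else 0)\<bar>
      \<le> (\<Sum>i=1..N. \<bar>p i * (if i < j then b i j k else 0)\<bar>)"
    by (rule sum_abs)
  also have "\<dots> \<le> (\<Sum>i=1..N. if i < j then m * (real i * b i j k) else 0)"
  proof (rule sum_mono)
    fix i assume i: "i \<in> {1..N}"
    show "\<bar>p i * (if i < j then b i j k else 0)\<bar> \<le> (if i < j then m * (real i * b i j k) else 0)"
    proof (cases "i < j")
      case True
      then have "0 \<le> b i j k"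
        using i assms by (intro b_nonneg) auto
      moreover have "\<bar>p i\<bar> * b i j k \<le> real i * m * b i j k"
        using i True \<open>0 \<le> b i j k\<close> by (intro mult_right_mono p) auto
      ultimately show ?thesis
        using True by (simp add: abs_mult mult_ac)
    qed simp
  qed
  also have "\<dots> = (\<Sum>i\<in>{1..N} \<inter> {1..j-1}. m * (real i * b i j k))"
    by (rule sum.mono_neutral_cong_right) auto
  also have "\<dots> \<le> (\<Sum>i=1..j-1. m * (real i * b i j k))"
    using assms by (intro sum_mono2) (auto intro!: mult_nonneg_nonneg b_nonneg)
  \<comment> \<open>For \<open>j = 1\<close> there are no fragments and the sum is 0; for
    \<open>j \<ge> 2\<close> this is mass conservation.\<close>
  also have "\<dots> \<le> m * real j"
    using b_mass[of j k] assms by (cases "2 \<le> j") (auto simp: sum_distrib_left[symmetric])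
  finally show ?thesis .
qed

lemma b_le:
  assumes "1 \<le> i" "i < j" "1 \<le> k"
  shows "0 \<le> b i j k" "b i j k \<le> real j"
proof -
  show "0 \<le> b i j k"
    using assms by (intro b_nonneg) auto
  \<comment> \<open>The weight is the indicator of the index \<open>i\<close>, which is at most
    \<open>l\<close> because \<open>1 \<le> l\<close>; hence \<open>m = 1\<close>.\<close>
  have "\<bar>\<Sum>l=1..i. (if l = i then 1 else 0) * (if l < j then b l j k else 0)\<bar> \<le> 1 * real j"
    using assms by (intro weighted_fragments_bound) auto
  also have "(\<Sum>l=1..i. (if l = i then 1 else 0) * (if l < j then b l j k else 0)) = b i j k"
    using assms by (subst sum.remove[where x = i]) auto
  finally show "b i j k \<le> real j"
    by simp
qed

lemma abs_kern_le: "1 \<le> i \<Longrightarrow> 1 \<le> j \<Longrightarrow> 1 \<le> k \<Longrightarrow> \<bar>kern i j k\<bar> \<le> real j"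
  using b_le[of i j k] by (auto simp: kern_def)

text \<open>The exponent of \<open>k\<close> is deliberately raised from \<gamma> to 1 + \<gamma>,
  the exponent of the norm in which solutions have uniformly small tails.\<close>

lemma a_le:
  assumes "1 \<le> j" "1 \<le> k"
  shows "\<bar>a j k\<bar> \<le> A * real j powr \<gamma> * real k powr (1 + \<gamma>)"
proof -
  have "\<bar>a j k\<bar> \<le> A * (real j * real k) powr \<gamma>"
    using assms a_nonneg a_bound by simp
  also have "\<dots> = A * real j powr \<gamma> * real k powr \<gamma>"
    by (simp add: powr_mult)
  also have "\<dots> \<le> A * real j powr \<gamma> * real k powr (1 + \<gamma>)"
    using A_pos assms by (intro mult_left_mono powr_mono) auto
  finally show ?thesis .
qed

lemma weighted_rate_le:
  assumes "1 \<le> j" "1 \<le> k" "\<bar>c\<bar> \<le> B * real j" "0 \<le> B"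
  shows "\<bar>c * a j k\<bar> \<le> A * B * real j powr (1 + \<gamma>) * real k powr \<gamma>"
proof -
  have "\<bar>c * a j k\<bar> = \<bar>c\<bar> * a j k"
    using a_nonneg[OF assms(1,2)] by (simp add: abs_mult)
  also have "\<dots> \<le> (B * real j) * (A * (real j * real k) powr \<gamma>)"
    using assms a_bound[OF assms(1,2)] a_nonneg[OF assms(1,2)] by (intro mult_mono) auto
  also have "\<dots> = A * B * real j powr (1 + \<gamma>) * real k powr \<gamma>"
    using assms by (simp add: powr_add powr_mult)
  finally show ?thesis .
qed

text \<open>A coefficient of size \<open>B * j\<close> adds one power of \<open>j\<close> to the
  collision rate, so the first sequence needs the exponent 1 + \<gamma> and the second only
  \<gamma>.\<close>

lemma rate_sum:
  assumes "y \<in> Y_space (1 + \<gamma>)" "z \<in> Y_space \<gamma>" "0 \<le> B"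
    and c: "\<And>j k. 1 \<le> j \<Longrightarrow> 1 \<le> k \<Longrightarrow> \<bar>c j k\<bar> \<le> B * real j"
  shows "(\<lambda>(j, k). c j k * a j k * y j * z k) summable_on {1..} \<times> {1..}"
    and "(\<Sum>\<^sub>\<infinity>(j, k)\<in>{1..} \<times> {1..}. c j k * a j k * y j * z k)
      \<le> A * B * Y_norm (1 + \<gamma>) y * Y_norm \<gamma> z"
proof -
  have *: "\<bar>c j k * a j k\<bar> \<le> A * B * real j powr (1 + \<gamma>) * real k powr \<gamma>" if "1 \<le> j" "1 \<le> k" for j k
    using weighted_rate_le that c assms(3) by blast
  show "(\<lambda>(j, k). c j k * a j k * y j * z k) summable_on {1..} \<times> {1..}"
    by (rule bilinear_sum(1)[OF assms(1,2) _ *]) (use A_pos assms in auto)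
  show "(\<Sum>\<^sub>\<infinity>(j, k)\<in>{1..} \<times> {1..}. c j k * a j k * y j * z k)
      \<le> A * B * Y_norm (1 + \<gamma>) y * Y_norm \<gamma> z"
    using bilinear_sum(2)[OF assms(1,2) _ *] A_pos assms by auto
qed

lemma Y_space_gamma: "y \<in> Y_space (1 + \<gamma>) \<Longrightarrow> y \<in> Y_space \<gamma>"
  by (rule Y_space_exponent_mono) auto

lemma loss_eq: "loss a y i = y i * (\<Sum>\<^sub>\<infinity>j\<in>{1..}. a i j * y j)"
proof -
  have "loss a y i = (\<Sum>\<^sub>\<infinity>j\<in>{1..}. y i * (a i j * y j))"
    unfolding loss_def by (intro infsum_cong) simp
  then show ?thesis
    by (simp add: infsum_cmult_right')
qed

text \<open>In \<open>Y_space (1 + \<gamma>)\<close> gain and loss both converge absolutely over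
  pairs, so they merge into one series. The loss is read as a double sum whose outer index takes
  only the value \<open>i\<close>.\<close>

lemma net_eq_infsum:
  assumes y: "y \<in> Y_space (1 + \<gamma>)" and i: "1 \<le> i"
  shows "(\<lambda>(j, k). kern i j k * a j k * y j * y k) summable_on {1..} \<times> {1..}"
    and "net y i = (\<Sum>\<^sub>\<infinity>(j, k)\<in>{1..} \<times> {1..}. kern i j k * a j k * y j * y k)"
proof -
  let ?g = "\<lambda>(j, k). (if i < j then b i j k else 0) * a j k * y j * y k"
  let ?l = "\<lambda>(j, k). (if i = j then 1 else 0) * a j k * y j * y k"
  note yg = Y_space_gamma[OF y]
  have g: "?g summable_on {1..} \<times> {1..}"
    by (rule rate_sum(1)[OF y yg, where B = 1]) (use i b_le in auto)
  have l: "?l summable_on {1..} \<times> {1..}"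
    by (rule rate_sum(1)[OF y yg, where B = 1]) auto
  have "gain a b y i = (\<Sum>\<^sub>\<infinity>j\<in>{1..}. \<Sum>\<^sub>\<infinity>k\<in>{1..}. (if i < j then b i j k else 0) * a j k * y j * y k)"
    unfolding gain_def by (rule infsum_cong_neutral) (use i in auto)
  also have "\<dots> = infsum ?g ({1..} \<times> {1..})"
    by (rule infsum_Sigma'_banach[OF g])
  finally have gain: "gain a b y i = infsum ?g ({1..} \<times> {1..})" .
  have "loss a y i = (\<Sum>\<^sub>\<infinity>j\<in>{i}. \<Sum>\<^sub>\<infinity>k\<in>{1..}. a j k * y j * y k)"
    by (simp add: loss_def)
  also have "\<dots> = (\<Sum>\<^sub>\<infinity>j\<in>{1..}. \<Sum>\<^sub>\<infinity>k\<in>{1..}. (if i = j then 1 else 0) * a j k * y j * y k)"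
    by (rule infsum_cong_neutral) (use i in auto)
  also have "\<dots> = infsum ?l ({1..} \<times> {1..})"
    by (rule infsum_Sigma'_banach[OF l])
  finally have loss: "loss a y i = infsum ?l ({1..} \<times> {1..})" .
  have eq: "(\<lambda>(j, k). kern i j k * a j k * y j * y k) = (\<lambda>x. ?g x - ?l x)"
    by (auto simp: kern_def fun_eq_iff algebra_simps)
  have "((\<lambda>(j, k). kern i j k * a j k * y j * y k) has_sum net y i) ({1..} \<times> {1..})"
    unfolding eq net_def gain loss by (intro has_sum_diff has_sum_infsum g l)
  then show "(\<lambda>(j, k). kern i j k * a j k * y j * y k) summable_on {1..} \<times> {1..}"
    "net y i = (\<Sum>\<^sub>\<infinity>(j, k)\<in>{1..} \<times> {1..}. kern i j k * a j k * y j * y k)"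
    by (simp_all only: has_sum_iff)
qed

section \<open>Truncated weak formulation\<close>

definition weighted_kern :: "(nat \<Rightarrow> real) \<Rightarrow> nat \<Rightarrow> nat \<Rightarrow> nat \<Rightarrow> real"
  where "weighted_kern p N j k = (\<Sum>i=1..N. p i * kern i j k)"

text \<open>Fragments up to size \<open>N\<close> are always counted, but the disappearance of the
  parent only if \<open>j \<le> N\<close>. This asymmetry is the source of the truncation
  errors.\<close>

lemma weighted_kern_eq:
  "1 \<le> j \<Longrightarrow> weighted_kern p N j k =
    (\<Sum>i=1..N. p i * (if i < j then b i j k else 0)) - (if j \<le> N then p j else 0)"
  by (simp add: weighted_kern_def kern_def right_diff_distrib sum_subtractf mult_delta_right)

text \<open>The finite sum over \<open>i\<close> is taken inside the absolutely convergent double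
  series, which leaves one coefficient per collision.\<close>

lemma weak_form:
  assumes y: "y \<in> Y_space (1 + \<gamma>)"
  shows "(\<lambda>(j, k). weighted_kern p N j k * a j k * y j * y k) summable_on {1..} \<times> {1..}"
    and "(\<Sum>i=1..N. p i * net y i)
      = (\<Sum>\<^sub>\<infinity>(j, k)\<in>{1..} \<times> {1..}. weighted_kern p N j k * a j k * y j * y k)"
proof -
  let ?f = "\<lambda>i (j, k). p i * (kern i j k * a j k * y j * y k)"
  have "((\<lambda>x. \<Sum>i=1..N. ?f i x) has_sum (\<Sum>i=1..N. p i * net y i)) ({1..} \<times> {1..})"
  proof (rule has_sum_sum[OF finite_atLeastAtMost])
    fix i assume "i \<in> {1..N}"
    then have "((\<lambda>(j, k). kern i j k * a j k * y j * y k) has_sum net y i) ({1..} \<times> {1..})"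
      using net_eq_infsum[OF y, of i] unfolding has_sum_iff by simp
    from has_sum_cmult_right[OF this, of "p i"] show "(?f i has_sum p i * net y i) ({1..} \<times> {1..})"
      by (simp add: case_prod_unfold)
  qed
  also have "(\<lambda>x. \<Sum>i=1..N. ?f i x) = (\<lambda>(j, k). weighted_kern p N j k * a j k * y j * y k)"
    by (auto simp: weighted_kern_def fun_eq_iff sum_distrib_right mult.assoc)
  finally show "(\<lambda>(j, k). weighted_kern p N j k * a j k * y j * y k) summable_on {1..} \<times> {1..}"
    "(\<Sum>i=1..N. p i * net y i)
      = (\<Sum>\<^sub>\<infinity>(j, k)\<in>{1..} \<times> {1..}. weighted_kern p N j k * a j k * y j * y k)"
    by (simp_all only: has_sum_iff)
qed

text \<open>A fragment is smaller than its parent, so a nondecreasing \<open>\<psi>\<close> gives it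
  no larger weight per unit of mass, and collisions with \<open>j \<le> N\<close> do not raise the
  sum. For \<open>j > N\<close> the lost parent is not counted and the fragments contribute at most
  \<open>B * j\<close>, whence the tail of \<open>y\<close>.\<close>

lemma superlinear_weight_net_le:
  assumes y: "y \<in> Y_pos (1 + \<gamma>)" and "0 \<le> B"
    and \<psi>: "mono \<psi>" "\<And>i. 0 \<le> \<psi> i" "\<And>i. \<psi> i \<le> B"
  shows "(\<Sum>i=1..N. real i * \<psi> i * net y i)
    \<le> A * B * Y_norm (1 + \<gamma>) (seq_tail N y) * Y_norm \<gamma> y"
proof -
  have ys: "y \<in> Y_space (1 + \<gamma>)" and y0: "\<And>i. 1 \<le> i \<Longrightarrow> 0 \<le> y i"
    using y by (auto simp: Y_pos_def)
  note tail = seq_tail_Y_space(1)[OF ys, of N] and yg = Y_space_gamma[OF ys]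
  let ?p = "\<lambda>i. real i * \<psi> i"
  have K: "weighted_kern ?p N j k \<le> (if j \<le> N then 0 else B * real j)" if "1 \<le> j" "1 \<le> k" for j k
  proof -
    define S where "S = (\<Sum>i=1..N. ?p i * (if i < j then b i j k else 0))"
    have "weighted_kern ?p N j k = S - (if j \<le> N then \<psi> j * real j else 0)"
      unfolding S_def using weighted_kern_eq[OF that(1), of ?p N k] by (simp add: mult.commute)
    moreover have "\<bar>S\<bar> \<le> \<psi> j * real j"
      unfolding S_def using that \<psi> by (intro weighted_fragments_bound) (auto intro!: mult_left_mono monoD[OF \<psi>(1)])
    moreover have "\<psi> j * real j \<le> B * real j"
      using \<psi> by (intro mult_right_mono) auto
    ultimately show ?thesis
      by (smt (verit))
  qed
  have "(\<Sum>i=1..N. ?p i * net y i)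
      = (\<Sum>\<^sub>\<infinity>(j, k)\<in>{1..} \<times> {1..}. weighted_kern ?p N j k * a j k * y j * y k)"
    by (rule weak_form[OF ys])
  also have "\<dots> \<le> (\<Sum>\<^sub>\<infinity>(j, k)\<in>{1..} \<times> {1..}. B * real j * a j k * seq_tail N y j * y k)"
  proof (rule infsum_mono[OF weak_form(1)[OF ys]])
    show "(\<lambda>(j, k). B * real j * a j k * seq_tail N y j * y k) summable_on {1..} \<times> {1..}"
      by (rule rate_sum(1)[OF tail yg \<open>0 \<le> B\<close>]) (use \<open>0 \<le> B\<close> in auto)
    fix x :: "nat \<times> nat" assume "x \<in> {1..} \<times> {1..}"
    then obtain j k where x: "x = (j, k)" and jk: "1 \<le> j" "1 \<le> k"
      by (cases x) auto
    have "weighted_kern ?p N j k * (a j k * y j * y k)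
        \<le> (if j \<le> N then 0 else B * real j) * (a j k * y j * y k)"
      using K jk y0 a_nonneg by (intro mult_right_mono) auto
    then show "(case x of (j, k) \<Rightarrow> weighted_kern ?p N j k * a j k * y j * y k)
        \<le> (case x of (j, k) \<Rightarrow> B * real j * a j k * seq_tail N y j * y k)"
      by (auto simp: x seq_tail_def mult_ac)
  qed
  also have "\<dots> \<le> A * B * Y_norm (1 + \<gamma>) (seq_tail N y) * Y_norm \<gamma> y"
    by (rule rate_sum(2)[OF tail yg \<open>0 \<le> B\<close>]) (use \<open>0 \<le> B\<close> in auto)
  finally show ?thesis .
qed

text \<open>Here \<open>s\<close> is a smoothed sign of \<open>y - z\<close> with defect
  \<open>\<epsilon>\<close>. With \<open>u = y - z\<close>, loss cancels gain in the terms
  \<open>u j * y k\<close>, except for \<open>j > N\<close> and for the defect. The terms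
  \<open>z j * u k\<close> have no favourable sign, so their gain and loss are both estimated in
  absolute value, which gives the factor 2.\<close>

lemma net_diff_le:
  assumes y: "y \<in> Y_pos (1 + \<gamma>)" and z: "z \<in> Y_pos (1 + \<gamma>)" and \<epsilon>: "0 \<le> \<epsilon>"
    and s: "\<And>i. \<bar>s i\<bar> \<le> 1" "\<And>i. \<bar>y i - z i\<bar> - \<epsilon> \<le> s i * (y i - z i)"
  shows "(\<Sum>i=1..N. real i * s i * (net y i - net z i))
    \<le> 2 * A * Y_norm (1 + \<gamma>) z * Y_norm 1 (y - z)
      + A * (Y_norm (1 + \<gamma>) (seq_tail N (y - z)) + \<epsilon> * (\<Sum>i=1..N. real i powr (1 + \<gamma>))) * Y_norm (1 + \<gamma>) y"
proof -
  have ys: "y \<in> Y_space (1 + \<gamma>)" and y0: "\<And>i. 1 \<le> i \<Longrightarrow> 0 \<le> y i"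
    and zs: "z \<in> Y_space (1 + \<gamma>)" and z0: "\<And>i. 1 \<le> i \<Longrightarrow> 0 \<le> z i"
    using y z by (auto simp: Y_pos_def)
  note yg = Y_space_gamma[OF ys]
  define u where "u = y - z"
  let ?abs = "\<lambda>x i :: nat. \<bar>x i\<bar> :: real"
  have us: "u \<in> Y_space (1 + \<gamma>)"
    unfolding u_def by (rule Y_space_diff[OF ys zs])
  have ug: "?abs u \<in> Y_space \<gamma>"
    using Y_space_gamma[OF us] by (simp add: Y_space_def)
  have ts: "?abs (seq_tail N u) \<in> Y_space (1 + \<gamma>)"
    using seq_tail_Y_space(1)[OF us] by (simp add: Y_space_def)
  define h where "h = (\<lambda>i. if i \<le> N then \<epsilon> else 0)"
  have hs: "h \<in> Y_space (1 + \<gamma>)" and hn: "Y_norm (1 + \<gamma>) h = \<epsilon> * (\<Sum>i=1..N. real i powr (1 + \<gamma>))"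
  proof -
    have "((\<lambda>i. real i powr (1 + \<gamma>) * \<bar>h i\<bar>) has_sum (\<Sum>i=1..N. \<epsilon> * real i powr (1 + \<gamma>))) {1..}"
      by (subst has_sum_cong_neutral[where S = "{1..}" and T = "{1..N}" and g = "\<lambda>i. \<epsilon> * real i powr (1 + \<gamma>)"])
        (use \<epsilon> in \<open>auto simp: h_def intro: has_sum_finite\<close>)
    then show "h \<in> Y_space (1 + \<gamma>)" "Y_norm (1 + \<gamma>) h = \<epsilon> * (\<Sum>i=1..N. real i powr (1 + \<gamma>))"
      by (auto simp: Y_space_def Y_norm_def has_sum_iff sum_distrib_left)
  qed
  let ?p = "\<lambda>i. real i * s i"
  let ?W = "weighted_kern ?p N"
  \<comment> \<open>Majorants of the truncation error, of the smoothing error and of the terms in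
    which \<open>u\<close> sits at the partner.\<close>
  let ?f1 = "\<lambda>(j, k). real j * a j k * \<bar>seq_tail N u j\<bar> * y k"
  let ?f2 = "\<lambda>(j, k). real j * a j k * h j * y k"
  let ?f3 = "\<lambda>(j, k). real j * a j k * z j * \<bar>u k\<bar>"
  let ?P = "{1::nat..} \<times> {1::nat..}"
  have f1: "?f1 summable_on ?P" "infsum ?f1 ?P \<le> A * 1 * Y_norm (1 + \<gamma>) (?abs (seq_tail N u)) * Y_norm \<gamma> y"
    using rate_sum[OF ts yg, of 1 "\<lambda>j k. real j"] by auto
  have f2: "?f2 summable_on ?P" "infsum ?f2 ?P \<le> A * 1 * Y_norm (1 + \<gamma>) h * Y_norm \<gamma> y"
    using rate_sum[OF hs yg, of 1 "\<lambda>j k. real j"] by auto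
  have f3: "?f3 summable_on ?P" "infsum ?f3 ?P \<le> A * 1 * Y_norm (1 + \<gamma>) z * Y_norm \<gamma> (?abs u)"
    using rate_sum[OF zs ug, of 1 "\<lambda>j k. real j"] by auto
  let ?G = "\<lambda>x. ?f1 x + ?f2 x + 2 * ?f3 x"
  have G: "?G summable_on ?P"
    by (intro summable_on_add summable_on_cmult_right f1 f2 f3)
  note wy = weak_form[OF ys, of ?p N] and wz = weak_form[OF zs, of ?p N]
  have D: "((\<lambda>x. (case x of (j, k) \<Rightarrow> ?W j k * a j k * y j * y k)
      - (case x of (j, k) \<Rightarrow> ?W j k * a j k * z j * z k))
      has_sum (\<Sum>i=1..N. ?p i * net y i) - (\<Sum>i=1..N. ?p i * net z i)) ?P"
    unfolding wy(2) wz(2) by (intro has_sum_diff has_sum_infsum wy(1) wz(1))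
  have "(\<Sum>i=1..N. ?p i * (net y i - net z i)) = (\<Sum>i=1..N. ?p i * net y i) - (\<Sum>i=1..N. ?p i * net z i)"
    by (simp add: right_diff_distrib sum_subtractf)
  also have "\<dots> = (\<Sum>\<^sub>\<infinity>x\<in>?P. (case x of (j, k) \<Rightarrow> ?W j k * a j k * y j * y k)
      - (case x of (j, k) \<Rightarrow> ?W j k * a j k * z j * z k))"
    using infsumI[OF D] by simp
  also have "\<dots> \<le> infsum ?G ?P"
  proof (rule infsum_mono[OF has_sum_imp_summable[OF D] G])
    fix x :: "nat \<times> nat" assume "x \<in> ?P"
    then obtain j k where x: "x = (j, k)" and jk: "1 \<le> j" "1 \<le> k"
      by (cases x) auto
    define S where "S = (\<Sum>i=1..N. ?p i * (if i < j then b i j k else 0))"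
    have S: "\<bar>S\<bar> \<le> 1 * real j"
      unfolding S_def using jk s by (intro weighted_fragments_bound) (auto simp: abs_mult mult_left_le)
    have W: "?W j k = S - (if j \<le> N then ?p j else 0)"
      unfolding S_def by (rule weighted_kern_eq[OF jk(1)])
    have "S * u j \<le> \<bar>S\<bar> * \<bar>u j\<bar>"
      by (metis abs_ge_self abs_mult)
    also have "\<dots> \<le> real j * \<bar>u j\<bar>"
      using S by (intro mult_right_mono) auto
    finally have Su: "S * u j \<le> real j * \<bar>u j\<bar>" .
    have su: "real j * (\<bar>u j\<bar> - \<epsilon>) \<le> real j * (s j * u j)"
      using s(2)[of j] by (intro mult_left_mono) (auto simp: u_def)
    \<comment> \<open>For \<open>j \<le> N\<close> the terms \<open>j * \<bar>u j\<bar>\<close> from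
      gain and loss cancel and leave \<open>j * \<epsilon>\<close>; for \<open>j > N\<close> there
      is no loss and the gain remains as a tail term.\<close>
    have 1: "?W j k * u j \<le> real j * (\<bar>seq_tail N u j\<bar> + h j)"
      using Su su by (auto simp: W seq_tail_def h_def algebra_simps)
    have "\<bar>?p j\<bar> \<le> real j"
      using s(1)[of j] by (simp add: abs_mult mult_left_le)
    then have "\<bar>S - ?p j\<bar> \<le> 2 * real j" "\<bar>S\<bar> \<le> 2 * real j"
      using S by linarith+
    then have "\<bar>?W j k\<bar> \<le> 2 * real j"
      unfolding W by simp
    then have "\<bar>?W j k\<bar> * \<bar>u k\<bar> \<le> 2 * real j * \<bar>u k\<bar>"
      by (rule mult_right_mono) simp
    then have 2: "?W j k * u k \<le> 2 * real j * \<bar>u k\<bar>"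
      by (simp flip: abs_mult)
    have "?W j k * a j k * y j * y k - ?W j k * a j k * z j * z k
        = (?W j k * u j) * (a j k * y k) + (?W j k * u k) * (a j k * z j)"
      by (simp add: u_def algebra_simps)
    also have "\<dots> \<le> (real j * (\<bar>seq_tail N u j\<bar> + h j)) * (a j k * y k) + (2 * real j * \<bar>u k\<bar>) * (a j k * z j)"
      using 1 2 jk y0 z0 a_nonneg by (intro add_mono mult_right_mono) auto
    also have "\<dots> = ?G x"
      by (simp add: x algebra_simps)
    finally show "(case x of (j, k) \<Rightarrow> ?W j k * a j k * y j * y k)
      - (case x of (j, k) \<Rightarrow> ?W j k * a j k * z j * z k) \<le> ?G x"
      by (simp add: x)
  qed
  also have "infsum ?G ?P = infsum ?f1 ?P + infsum ?f2 ?P + 2 * infsum ?f3 ?P"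
    by (intro infsumI has_sum_add has_sum_cmult_right has_sum_infsum f1 f2 f3)
  also have "\<dots> \<le> A * (Y_norm (1 + \<gamma>) (seq_tail N u) + Y_norm (1 + \<gamma>) h) * Y_norm \<gamma> y
      + 2 * (A * Y_norm (1 + \<gamma>) z * Y_norm \<gamma> u)"
    using f1(2) f2(2) f3(2) by (simp add: Y_norm_def algebra_simps)
  \<comment> \<open>Because \<open>\<gamma> \<le> 1\<close>, the norm of \<open>u\<close> with
    exponent \<gamma> is at most \<open>Y_norm 1 u\<close>, the quantity to be estimated.\<close>
  also have "\<dots> \<le> A * (Y_norm (1 + \<gamma>) (seq_tail N u) + Y_norm (1 + \<gamma>) h) * Y_norm (1 + \<gamma>) y
      + 2 * (A * Y_norm (1 + \<gamma>) z * Y_norm 1 u)"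
    using A_pos gamma Y_space_exponent_mono[OF ys, of \<gamma>] Y_space_exponent_mono[OF us, of 1]
      Y_space_exponent_mono(2)[of u 1 \<gamma>]
    by (intro add_mono mult_left_mono) (auto simp: Y_norm_nonneg)
  finally show ?thesis
    by (simp add: hn u_def algebra_simps)
qed

end

subsection \<open>Propagation of moments and regularity of solutions\<close>

locale breakage_solution = breakage_kernel +
  fixes w_in :: "nat \<Rightarrow> real" and w :: "real \<Rightarrow> nat \<Rightarrow> real"
  assumes w_in: "w_in \<in> Y_pos (1 + \<gamma>)"
    and sol: "cib_solution a b \<infinity> w_in w"
    and Linf: "\<And>T. 0 < T \<Longrightarrow> Linf_Y_pos (1 + \<gamma>) {0<..<T} w"
begin

lemma w_in_space: "w_in \<in> Y_space (1 + \<gamma>)" and w_in_nonneg: "1 \<le> i \<Longrightarrow> 0 \<le> w_in i"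
  using w_in by (auto simp: Y_pos_def)

lemma w_nonneg: "1 \<le> i \<Longrightarrow> 0 \<le> t \<Longrightarrow> 0 \<le> w t i"
  using sol by (simp add: cib_solution_def)

lemma w_continuous: "1 \<le> i \<Longrightarrow> continuous_on {0..} (\<lambda>t. w t i)"
  using sol by (simp add: cib_solution_def atLeast_def)

text \<open>A solution comes with integrability of the series in the loss without the factor
  \<open>w \<tau> i\<close>. That factor is continuous, hence bounded on \<open>{0..t}\<close>, so
  the product is integrable.\<close>

lemma integrable_net:
  assumes i: "1 \<le> i" and t: "0 < t"
  shows "integrable (lebesgue_on {0<..<t}) (\<lambda>\<tau>. net (w \<tau>) i)"
    and "w t i = w_in i + (\<integral>\<tau>. net (w \<tau>) i \<partial>lebesgue_on {0<..<t})"
proof -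
  let ?M = "lebesgue_on {0<..<t}" and ?S = "\<lambda>\<tau>. \<Sum>\<^sub>\<infinity>j\<in>{1..}. a i j * w \<tau> j"
  have g: "integrable ?M (\<lambda>\<tau>. gain a b (w \<tau>) i)" and S: "integrable ?M ?S"
    and eq: "w t i = w_in i + (\<integral>\<tau>. gain a b (w \<tau>) i - loss a (w \<tau>) i \<partial>?M)"
    using sol i t by (auto simp: cib_solution_def)
  have "bounded ((\<lambda>\<tau>. w \<tau> i) ` {0..t})"
    by (intro compact_imp_bounded compact_continuous_image continuous_on_subset[OF w_continuous[OF i]]) auto
  then obtain K where K: "\<And>\<tau>. \<tau> \<in> {0..t} \<Longrightarrow> \<bar>w \<tau> i\<bar> \<le> K"
    unfolding bounded_iff by fastforce
  have "(\<lambda>\<tau>. w \<tau> i) \<in> borel_measurable ?M"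
    by (intro continuous_imp_measurable_on_sets_lebesgue continuous_on_subset[OF w_continuous[OF i]]) auto
  then have meas: "(\<lambda>\<tau>. w \<tau> i * ?S \<tau>) \<in> borel_measurable ?M"
    using S by measurable
  have "AE \<tau> in ?M. norm (w \<tau> i * ?S \<tau>) \<le> norm (K * ?S \<tau>)"
  proof (rule AE_I2)
    fix \<tau> assume "\<tau> \<in> space ?M"
    then have "\<bar>w \<tau> i\<bar> \<le> \<bar>K\<bar>"
      using K[of \<tau>] by (simp add: space_restrict_space)
    then show "norm (w \<tau> i * ?S \<tau>) \<le> norm (K * ?S \<tau>)"
      by (simp add: abs_mult mult_right_mono)
  qed
  then have "integrable ?M (\<lambda>\<tau>. w \<tau> i * ?S \<tau>)"
    using Bochner_Integration.integrable_bound[OF integrable_mult_right[OF S, of K] meas] by simp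
  then have l: "integrable ?M (\<lambda>\<tau>. loss a (w \<tau>) i)"
    by (simp add: loss_eq)
  show "integrable ?M (\<lambda>\<tau>. net (w \<tau>) i)"
    unfolding net_def by (intro Bochner_Integration.integrable_diff g l)
  show "w t i = w_in i + (\<integral>\<tau>. net (w \<tau>) i \<partial>?M)"
    unfolding net_def by (rule eq)
qed

lemma ae_bound:
  assumes "0 < t"
  obtains K where "0 \<le> K" "AE \<tau> in lebesgue_on {0<..<t}. w \<tau> \<in> Y_pos (1 + \<gamma>) \<and> Y_norm (1 + \<gamma>) (w \<tau>) \<le> K"
proof -
  from Linf[OF assms] obtain C where C: "AE \<tau> in lebesgue_on {0<..<t}. w \<tau> \<in> Y_pos (1 + \<gamma>)"
    "AE \<tau> in lebesgue_on {0<..<t}. Y_norm (1 + \<gamma>) (w \<tau>) \<le> C"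
    by (auto simp: Linf_Y_pos_def)
  from C have "AE \<tau> in lebesgue_on {0<..<t}. w \<tau> \<in> Y_pos (1 + \<gamma>) \<and> Y_norm (1 + \<gamma>) (w \<tau>) \<le> max 0 C"
    by eventually_elim auto
  then show ?thesis
    using that[of "max 0 C"] by auto
qed

text \<open>At truncation level \<open>M\<close> the moment grows by at most the time integral of an
  error proportional to the tail of \<open>w \<tau>\<close> beyond \<open>M\<close>. This error is
  bounded and tends to 0 at almost every time, so dominated convergence removes it.\<close>

lemma superlinear_moment_le:
  assumes t: "0 < t" and B: "0 \<le> B"
    and \<psi>: "mono \<psi>" "\<And>i. 0 \<le> \<psi> i" "\<And>i. \<psi> i \<le> B"
    and R: "\<And>M. (\<Sum>i=1..M. real i * \<psi> i * w_in i) \<le> R"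
  shows "(\<Sum>i=1..n. real i * \<psi> i * w t i) \<le> R"
proof -
  let ?L = "lebesgue_on {0<..<t}"
  obtain K where K: "0 \<le> K"
    "AE \<tau> in ?L. w \<tau> \<in> Y_pos (1 + \<gamma>) \<and> Y_norm (1 + \<gamma>) (w \<tau>) \<le> K"
    using ae_bound[OF t] .
  define h where "h = (\<lambda>M \<tau>. \<Sum>i=1..M. real i * \<psi> i * net (w \<tau>) i)"
  have h: "integrable ?L (h M)" for M
    unfolding h_def using t
    by (intro Bochner_Integration.integrable_sum integrable_mult_right integrable_net) auto
  have max_h: "integrable ?L (\<lambda>\<tau>. max 0 (h M \<tau>))" for M
    by (intro integrable_max h) auto
  have eq: "(\<Sum>i=1..M. real i * \<psi> i * w t i) = (\<Sum>i=1..M. real i * \<psi> i * w_in i) + (\<integral>\<tau>. h M \<tau> \<partial>?L)" for M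
  proof -
    have "(\<integral>\<tau>. h M \<tau> \<partial>?L) = (\<Sum>i=1..M. real i * \<psi> i * (\<integral>\<tau>. net (w \<tau>) i \<partial>?L))"
      unfolding h_def using t
      by (subst Bochner_Integration.integral_sum) (simp_all add: integrable_net)
    also have "\<dots> = (\<Sum>i=1..M. real i * \<psi> i * (w t i - w_in i))"
    proof (rule sum.cong)
      fix i assume "i \<in> {1..M}"
      then show "real i * \<psi> i * (\<integral>\<tau>. net (w \<tau>) i \<partial>?L) = real i * \<psi> i * (w t i - w_in i)"
        using integrable_net(2)[OF _ t, of i] by simp
    qed simp
    finally show ?thesis
      by (simp add: right_diff_distrib sum_subtractf)
  qed
  have h_le: "max 0 (h M \<tau>) \<le> A * B * Y_norm (1 + \<gamma>) (seq_tail M (w \<tau>)) * K"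
    if "w \<tau> \<in> Y_pos (1 + \<gamma>)" "Y_norm (1 + \<gamma>) (w \<tau>) \<le> K" for M \<tau>
  proof -
    have "w \<tau> \<in> Y_space (1 + \<gamma>)"
      using that by (simp add: Y_pos_def)
    from Y_space_exponent_mono(2)[OF this, of \<gamma>] have "Y_norm \<gamma> (w \<tau>) \<le> K"
      using that by simp
    have "h M \<tau> \<le> A * B * Y_norm (1 + \<gamma>) (seq_tail M (w \<tau>)) * Y_norm \<gamma> (w \<tau>)"
      unfolding h_def by (rule superlinear_weight_net_le[OF that(1) B \<psi>])
    also have "\<dots> \<le> A * B * Y_norm (1 + \<gamma>) (seq_tail M (w \<tau>)) * K"
      using A_pos B \<open>Y_norm \<gamma> (w \<tau>) \<le> K\<close> by (intro mult_left_mono mult_nonneg_nonneg) (auto simp: Y_norm_nonneg)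
    finally show ?thesis
      using A_pos B K(1) by (simp add: Y_norm_nonneg)
  qed
  \<comment> \<open>The estimate of \<open>h M\<close> is one-sided; its positive part is squeezed
    between 0 and the vanishing error.\<close>
  have "(\<lambda>M. \<integral>\<tau>. max 0 (h M \<tau>) \<partial>?L) \<longlonglongrightarrow> (\<integral>\<tau>. 0 \<partial>?L)"
  proof (rule integral_dominated_convergence)
    show "(\<lambda>\<tau>. max 0 (h M \<tau>)) \<in> borel_measurable ?L" for M
      by (rule borel_measurable_integrable[OF max_h])
    have "finite_measure ?L"
      by (rule finite_measure_lebesgue_on) (use lmeasurable_box[of 0 t] in auto)
    then show "integrable ?L (\<lambda>\<tau>. A * B * K * K)"
      by (rule finite_measure.integrable_const)
    show "AE \<tau> in ?L. norm (max 0 (h M \<tau>)) \<le> A * B * K * K" for M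
      using K(2)
    proof eventually_elim
      case (elim \<tau>)
      then have "w \<tau> \<in> Y_space (1 + \<gamma>)"
        by (simp add: Y_pos_def)
      have "max 0 (h M \<tau>) \<le> A * B * Y_norm (1 + \<gamma>) (seq_tail M (w \<tau>)) * K"
        using elim by (intro h_le) auto
      also have "\<dots> \<le> A * B * K * K"
        using A_pos B K(1) seq_tail_Y_space(2)[OF \<open>w \<tau> \<in> Y_space (1 + \<gamma>)\<close>, of M] elim
        by (intro mult_left_mono mult_right_mono mult_nonneg_nonneg) auto
      finally show ?case
        by simp
    qed
    show "AE \<tau> in ?L. (\<lambda>M. max 0 (h M \<tau>)) \<longlonglongrightarrow> 0"
      using K(2)
    proof eventually_elim
      case (elim \<tau>)
      then have "w \<tau> \<in> Y_space (1 + \<gamma>)"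
        by (simp add: Y_pos_def)
      have "(\<lambda>M. A * B * Y_norm (1 + \<gamma>) (seq_tail M (w \<tau>)) * K) \<longlonglongrightarrow> A * B * 0 * K"
        by (intro tendsto_intros seq_tail_tendsto_0 \<open>w \<tau> \<in> Y_space (1 + \<gamma>)\<close>)
      then have "(\<lambda>M. A * B * Y_norm (1 + \<gamma>) (seq_tail M (w \<tau>)) * K) \<longlonglongrightarrow> 0"
        by simp
      from tendsto_sandwich[OF _ _ tendsto_const this] show ?case
        using h_le elim by (simp add: always_eventually)
    qed
  qed auto
  then have "(\<lambda>M. R + (\<integral>\<tau>. max 0 (h M \<tau>) \<partial>?L)) \<longlonglongrightarrow> R + 0"
    by (intro tendsto_add tendsto_const) simp
  moreover have "(\<Sum>i=1..n. real i * \<psi> i * w t i) \<le> R + (\<integral>\<tau>. max 0 (h M \<tau>) \<partial>?L)" if "n \<le> M" for M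
  proof -
    have "(\<Sum>i=1..n. real i * \<psi> i * w t i) \<le> (\<Sum>i=1..M. real i * \<psi> i * w t i)"
      using that t \<psi>(2) w_nonneg by (intro sum_mono2) auto
    also have "\<dots> \<le> R + (\<integral>\<tau>. h M \<tau> \<partial>?L)"
      unfolding eq using R by simp
    also have "(\<integral>\<tau>. h M \<tau> \<partial>?L) \<le> (\<integral>\<tau>. max 0 (h M \<tau>) \<partial>?L)"
      by (rule integral_mono[OF h max_h]) simp
    finally show ?thesis
      by simp
  qed
  ultimately have "(\<Sum>i=1..n. real i * \<psi> i * w t i) \<le> R + 0"
    by (intro LIMSEQ_le_const) auto
  then show ?thesis
    by simp
qed

section \<open>Integral equation on closed intervals and the initial value\<close>

lemma net_integrable_on:
  assumes "1 \<le> i" "0 < t"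
  shows "(\<lambda>\<tau>. net (w \<tau>) i) integrable_on {0..t}"
proof -
  have "(\<lambda>\<tau>. net (w \<tau>) i) integrable_on {0<..<t}"
    using assms by (intro integrable_on_lebesgue_on integrable_net) auto
  then show ?thesis
    using integrable_on_open_interval[of "\<lambda>\<tau>. net (w \<tau>) i" 0 t] by simp
qed

lemma w_eq_integral_pos:
  assumes "1 \<le> i" "0 < t"
  shows "w t i = w_in i + integral {0..t} (\<lambda>\<tau>. net (w \<tau>) i)"
  using integrable_net[OF assms] lebesgue_integral_eq_integral[of "{0<..<t}" "\<lambda>\<tau>. net (w \<tau>) i"]
  by (simp add: integral_open_interval_real)

text \<open>The integral equation is imposed only for \<open>0 < t\<close>. The difference of
  \<open>w t i\<close> and the integral is continuous on \<open>{0..1}\<close> and equals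
  \<open>w_in i\<close> in the interior, hence also at 0.\<close>

lemma w_0:
  assumes i: "1 \<le> i"
  shows "w 0 i = w_in i"
proof -
  have cl: "closure {0<..<1::real} = {0..1}"
    by simp
  have "continuous_on {0..1} (\<lambda>t. w t i - integral {0..t} (\<lambda>\<tau>. net (w \<tau>) i))"
  proof (rule continuous_on_diff)
    show "continuous_on {0..1} (\<lambda>t. w t i)"
      by (rule continuous_on_subset[OF w_continuous[OF i]]) auto
    show "continuous_on {0..1} (\<lambda>t. integral {0..t} (\<lambda>\<tau>. net (w \<tau>) i))"
      by (rule indefinite_integral_continuous_1[OF net_integrable_on[OF i]]) simp
  qed
  then have "w 0 i - integral {0..0} (\<lambda>\<tau>. net (w \<tau>) i) = w_in i"
    using w_eq_integral_pos[OF i]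
      continuous_constant_on_closure[of "{0<..<1}" "\<lambda>t. w t i - integral {0..t} (\<lambda>\<tau>. net (w \<tau>) i)" "w_in i" 0]
    unfolding cl by simp
  then show ?thesis
    by simp
qed

lemma w_eq_integral:
  assumes "1 \<le> i" "0 \<le> t"
  shows "w t i = w_in i + integral {0..t} (\<lambda>\<tau>. net (w \<tau>) i)"
  using assms w_eq_integral_pos[of i t] w_0[of i] by (cases "t = 0") auto

text \<open>For each \<open>m\<close> the weight that is 0 up to \<open>m\<close> and
  \<open>i powr \<gamma>\<close> beyond is nondecreasing, so every tail obeys the moment estimate.
  The bound holds at every time, whereas the assumption on \<open>w\<close> speaks of almost every
  time.\<close>

lemma
  assumes t: "0 \<le> t"
  shows tail_space: "seq_tail m (w t) \<in> Y_space (1 + \<gamma>)"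
    and tail_le: "Y_norm (1 + \<gamma>) (seq_tail m (w t)) \<le> Y_norm (1 + \<gamma>) (seq_tail m w_in)"
proof -
  let ?R = "Y_norm (1 + \<gamma>) (seq_tail m w_in)"
  have "(\<Sum>i=1..n. real i powr (1 + \<gamma>) * \<bar>seq_tail m (w t) i\<bar>) \<le> ?R" for n
  proof (cases "t = 0")
    case True
    then have "(\<Sum>i=1..n. real i powr (1 + \<gamma>) * \<bar>seq_tail m (w t) i\<bar>)
      = (\<Sum>i=1..n. real i powr (1 + \<gamma>) * \<bar>seq_tail m w_in i\<bar>)"
      by (intro sum.cong) (auto simp: seq_tail_def w_0)
    then show ?thesis
      using sum_le_Y_norm[OF seq_tail_Y_space(1)[OF w_in_space]] by simp
  next
    case False
    \<comment> \<open>Capping the index at \<open>n\<close> keeps \<open>\<psi>\<close> bounded, as the finiteness of only the \<open>(1 + \<gamma>)\<close>-moment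
        requires, and does not change the first \<open>n\<close> terms.\<close>
    define \<psi> where "\<psi> = (\<lambda>i. if m < i then real (min i n) powr \<gamma> else 0)"
    have \<psi>: "mono \<psi>" "\<And>i. 0 \<le> \<psi> i" "\<And>i. \<psi> i \<le> real n powr \<gamma>"
      using gamma by (auto simp: \<psi>_def mono_def intro!: powr_mono2)
    have "(\<Sum>i=1..n. real i powr (1 + \<gamma>) * \<bar>seq_tail m (w t) i\<bar>) = (\<Sum>i=1..n. real i * \<psi> i * w t i)"
      using w_nonneg t by (intro sum.cong) (auto simp: seq_tail_def \<psi>_def powr_add)
    also have "\<dots> \<le> ?R"
    proof (rule superlinear_moment_le[OF _ _ \<psi>])
      fix M
      have "(\<Sum>i=1..M. real i * \<psi> i * w_in i) \<le> (\<Sum>i=1..M. real i powr (1 + \<gamma>) * \<bar>seq_tail m w_in i\<bar>)"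
        using w_in_nonneg gamma
        by (intro sum_mono) (auto simp: seq_tail_def \<psi>_def powr_add intro!: mult_right_mono powr_mono2)
      also have "\<dots> \<le> ?R"
        by (rule sum_le_Y_norm[OF seq_tail_Y_space(1)[OF w_in_space]])
      finally show "(\<Sum>i=1..M. real i * \<psi> i * w_in i) \<le> ?R" .
    qed (use t False in auto)
    finally show ?thesis .
  qed
  then show "seq_tail m (w t) \<in> Y_space (1 + \<gamma>)" "Y_norm (1 + \<gamma>) (seq_tail m (w t)) \<le> ?R"
    by (auto intro!: Y_space_bounded_sums)
qed

section \<open>Uniform bounds, continuity and differentiability in time\<close>

lemma w_space: "0 \<le> t \<Longrightarrow> w t \<in> Y_space (1 + \<gamma>)"
  by (rule Y_space_mono[OF tail_space[of t 0]]) auto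

lemma w_pos: "0 \<le> t \<Longrightarrow> w t \<in> Y_pos (1 + \<gamma>)"
  using w_space w_nonneg by (auto simp: Y_pos_def)

lemma w_norm_le:
  assumes "0 \<le> t"
  shows "Y_norm (1 + \<gamma>) (w t) \<le> Y_norm (1 + \<gamma>) w_in"
proof -
  have "Y_norm (1 + \<gamma>) (w t) \<le> Y_norm (1 + \<gamma>) (seq_tail 0 (w t))"
    by (rule Y_space_mono[OF tail_space[OF assms]]) auto
  also have "\<dots> \<le> Y_norm (1 + \<gamma>) (seq_tail 0 w_in)"
    by (rule tail_le[OF assms])
  also have "\<dots> \<le> Y_norm (1 + \<gamma>) w_in"
    by (rule seq_tail_Y_space[OF w_in_space])
  finally show ?thesis .
qed

text \<open>The fixed dominating sequence is \<open>w_in\<close>, whose tails bound those of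
  \<open>w t\<close> at all times.\<close>

lemma continuous_on_infsum_w:
  fixes c :: "nat \<Rightarrow> real"
  assumes "0 \<le> C" "\<And>j. 1 \<le> j \<Longrightarrow> \<bar>c j\<bar> \<le> C * real j powr (1 + \<gamma>)"
  shows "continuous_on {0..} (\<lambda>t. \<Sum>\<^sub>\<infinity>j\<in>{1..}. c j * w t j)"
    and "0 \<le> t \<Longrightarrow> \<bar>\<Sum>\<^sub>\<infinity>j\<in>{1..}. c j * w t j\<bar> \<le> C * Y_norm (1 + \<gamma>) w_in"
proof -
  have *: "\<bar>c j * w t j\<bar> \<le> C * (real j powr (1 + \<gamma>) * \<bar>w t j\<bar>)" if "1 \<le> j" for j t
    using mult_right_mono[OF assms(2)[OF that], of "\<bar>w t j\<bar>"] by (simp add: abs_mult)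
  show "continuous_on {0..} (\<lambda>t. \<Sum>\<^sub>\<infinity>j\<in>{1..}. c j * w t j)"
    by (rule continuous_on_infsum_uniform_tail[OF w_in_space _ _ \<open>0 \<le> C\<close> *])
      (auto intro!: w_space tail_le continuous_intros w_continuous)
  assume t: "0 \<le> t"
  have "\<bar>\<Sum>\<^sub>\<infinity>j\<in>{1..}. c j * w t j\<bar> \<le> C * Y_norm (1 + \<gamma>) (w t)"
    by (rule dominated_infsum(2)[OF w_space[OF t] \<open>0 \<le> C\<close> *])
  also have "\<dots> \<le> C * Y_norm (1 + \<gamma>) w_in"
    using w_norm_le[OF t] \<open>0 \<le> C\<close> by (rule mult_left_mono)
  finally show "\<bar>\<Sum>\<^sub>\<infinity>j\<in>{1..}. c j * w t j\<bar> \<le> C * Y_norm (1 + \<gamma>) w_in" .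
qed

text \<open>Term-by-term continuity is applied to the gain twice: to the inner sums over
  \<open>k\<close>, which are bounded by a multiple of \<open>j powr (1 + \<gamma>)\<close>
  uniformly in time, and then to the outer sum over \<open>j\<close>.\<close>

lemma net_continuous:
  assumes i: "1 \<le> i"
  shows "continuous_on {0..} (\<lambda>t. net (w t) i)"
proof -
  have loss: "continuous_on {0..} (\<lambda>t. loss a (w t) i)"
    unfolding loss_eq
    by (intro continuous_intros w_continuous[OF i] continuous_on_infsum_w(1)[where C = "A * real i powr \<gamma>"])
      (use A_pos i a_le in auto)
  define G where "G = (\<lambda>j t. \<Sum>\<^sub>\<infinity>k\<in>{1..}. (b i j k * a j k) * w t k)"
  have c: "\<bar>b i j k * a j k\<bar> \<le> A * real j powr (1 + \<gamma>) * real k powr (1 + \<gamma>)" if "i < j" "1 \<le> k" for j k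
  proof -
    have "\<bar>b i j k * a j k\<bar> \<le> real j * (A * real j powr \<gamma> * real k powr (1 + \<gamma>))"
      unfolding abs_mult using that i b_le[OF i that] by (intro mult_mono a_le) auto
    also have "\<dots> = A * real j powr (1 + \<gamma>) * real k powr (1 + \<gamma>)"
      using that by (simp add: powr_add)
    finally show ?thesis .
  qed
  have G: "continuous_on {0..} (G j)" "\<And>t. 0 \<le> t \<Longrightarrow> \<bar>G j t\<bar> \<le> A * real j powr (1 + \<gamma>) * Y_norm (1 + \<gamma>) w_in"
    if "i < j" for j
    unfolding G_def
    using continuous_on_infsum_w[of "A * real j powr (1 + \<gamma>)" "\<lambda>k. b i j k * a j k", OF _ c[OF that]] A_pos
    by simp_all
  have "gain a b (w t) i = (\<Sum>\<^sub>\<infinity>j\<in>{1..}. if i < j then w t j * G j t else 0)" for t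
    unfolding gain_def
  proof (rule infsum_cong_neutral)
    fix j assume "j \<in> {i + 1..} \<inter> {1..}"
    then have "i < j"
      by simp
    have "(\<Sum>\<^sub>\<infinity>k\<in>{1..}. b i j k * a j k * w t j * w t k) = (\<Sum>\<^sub>\<infinity>k\<in>{1..}. w t j * (b i j k * a j k * w t k))"
      by (intro infsum_cong) simp
    then show "(\<Sum>\<^sub>\<infinity>k\<in>{1..}. b i j k * a j k * w t j * w t k) = (if i < j then w t j * G j t else 0)"
      using \<open>i < j\<close> by (simp add: infsum_cmult_right' G_def)
  qed (use i in auto)
  moreover have "continuous_on {0..} (\<lambda>t. \<Sum>\<^sub>\<infinity>j\<in>{1..}. if i < j then w t j * G j t else 0)"
  proof (rule continuous_on_infsum_uniform_tail[OF w_in_space _ _ _, where C = "A * Y_norm (1 + \<gamma>) w_in"])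
    fix j :: nat and t :: real assume j: "1 \<le> j" and t: "t \<in> {0..}"
    show "\<bar>if i < j then w t j * G j t else 0\<bar>
        \<le> A * Y_norm (1 + \<gamma>) w_in * (real j powr (1 + \<gamma>) * \<bar>w t j\<bar>)"
    proof (cases "i < j")
      case True
      have "\<bar>w t j\<bar> * \<bar>G j t\<bar> \<le> \<bar>w t j\<bar> * (A * real j powr (1 + \<gamma>) * Y_norm (1 + \<gamma>) w_in)"
        using G(2)[OF True] t by (intro mult_left_mono) auto
      then show ?thesis
        using True by (simp add: abs_mult mult_ac)
    qed (use A_pos in \<open>auto simp: Y_norm_nonneg\<close>)
  next
    fix j :: nat assume "1 \<le> j"
    show "continuous_on {0..} (\<lambda>t. if i < j then w t j * G j t else 0)"
      using G(1) \<open>1 \<le> j\<close> by (cases "i < j") (auto intro!: continuous_intros w_continuous)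
  qed (use A_pos w_space tail_le in \<open>auto simp: Y_norm_nonneg\<close>)
  ultimately have "continuous_on {0..} (\<lambda>t. gain a b (w t) i)"
    by simp
  with loss show ?thesis
    unfolding net_def by (intro continuous_intros)
qed

lemma w_has_derivative:
  assumes i: "1 \<le> i" and t: "0 < t"
  shows "((\<lambda>t. w t i) has_real_derivative net (w t) i) (at t)"
proof -
  let ?f = "\<lambda>t. w_in i + integral {0..t} (\<lambda>\<tau>. net (w \<tau>) i)"
  \<comment> \<open>The right end \<open>t+1\<close> makes \<open>t\<close> an interior point of the
    interval.\<close>
  have "((\<lambda>t. integral {0..t} (\<lambda>\<tau>. net (w \<tau>) i)) has_real_derivative net (w t) i) (at t within {0..t+1})"
    using t by (intro integral_has_real_derivative continuous_on_subset[OF net_continuous[OF i]]) auto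
  then have "((\<lambda>t. integral {0..t} (\<lambda>\<tau>. net (w \<tau>) i)) has_real_derivative net (w t) i) (at t)"
    using t by (simp add: at_within_Icc_at)
  then have "(?f has_real_derivative net (w t) i) (at t)"
    using DERIV_add[OF DERIV_const] by fastforce
  then show ?thesis
  proof (rule has_field_derivative_transform_within_open[where S = "{0<..}"])
    show "\<And>x. x \<in> {0<..} \<Longrightarrow> ?f x = w x i"
      using w_eq_integral[OF i] by simp
  qed (use t in auto)
qed

end

subsection \<open>Stability\<close>

text \<open>The function \<open>exp (- (c * t)) * F t - E * t\<close> is nonincreasing.\<close>

lemma affine_gronwall:
  fixes F F' :: "real \<Rightarrow> real"
  assumes "0 \<le> c" "0 \<le> E" "0 \<le> T"
    and cont: "continuous_on {0..T} F"
    and deriv: "\<And>t. 0 < t \<Longrightarrow> t < T \<Longrightarrow> (F has_real_derivative F' t) (at t)"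
    and le: "\<And>t. 0 < t \<Longrightarrow> t < T \<Longrightarrow> F' t \<le> c * F t + E"
  shows "F T \<le> exp (c * T) * (F 0 + E * T)"
proof -
  let ?G = "\<lambda>t. exp (- (c * t)) * F t - E * t"
  have "?G T \<le> ?G 0"
  proof (rule DERIV_nonpos_imp_decreasing_open[OF \<open>0 \<le> T\<close>])
    show "continuous_on {0..T} ?G"
      by (intro continuous_intros cont)
    fix t assume t: "0 < t" "t < T"
    have "(?G has_real_derivative exp (- (c * t)) * (F' t - c * F t) - E) (at t)"
      by (auto intro!: derivative_eq_intros deriv[OF t] simp: algebra_simps)
    moreover have "exp (- (c * t)) * (F' t - c * F t) \<le> 1 * E"
    \<comment> \<open>The factor \<open>exp (- (c * t)) \<le> 1\<close> may be dropped only from a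
      nonnegative quantity.\<close>
    proof (cases "0 \<le> F' t - c * F t")
      case True
      moreover have "F' t - c * F t \<le> E"
        using le[OF t] by simp
      ultimately show ?thesis
        using assms(1) t by (intro mult_mono) auto
    next
      case False
      then have "exp (- (c * t)) * (F' t - c * F t) \<le> 0"
        by (intro mult_nonneg_nonpos) auto
      then show ?thesis
        using assms by simp
    qed
    ultimately show "\<exists>y. (?G has_real_derivative y) (at t) \<and> y \<le> 0"
      by (intro exI conjI) auto
  qed
  then have "exp (- (c * T)) * F T \<le> F 0 + E * T"
    by simp
  then have "exp (c * T) * (exp (- (c * T)) * F T) \<le> exp (c * T) * (F 0 + E * T)"
    by (rule mult_left_mono) simp
  moreover have "exp (c * T) * (exp (- (c * T)) * F T) = F T"
    by (simp add: exp_minus_inverse flip: mult.assoc)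
  ultimately show ?thesis
    by simp
qed

locale breakage_solution_pair =
  w: breakage_solution a b \<gamma> A w_in w + v: breakage_solution a b \<gamma> A v_in v
  for a b \<gamma> A w_in w v_in v
begin

text \<open>Gronwall for the smoothed distance of the first \<open>N\<close> components. Here
  \<open>\<tau>\<close> bounds the tails of both solutions at all times and
  \<open>\<epsilon> * H\<close> is the smoothing defect in the rates; both enter only as additive
  errors.\<close>

lemma smoothed_distance_le:
  fixes N :: nat and \<epsilon> T :: real
  assumes \<epsilon>: "0 < \<epsilon>" and T: "0 \<le> T"
  defines "\<tau> \<equiv> Y_norm (1 + \<gamma>) (seq_tail N w_in) + Y_norm (1 + \<gamma>) (seq_tail N v_in)"
    and "H \<equiv> \<Sum>i=1..N. real i powr (1 + \<gamma>)"
    and "c \<equiv> 2 * A * Y_norm (1 + \<gamma>) v_in"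
  shows "(\<Sum>i=1..N. real i * \<bar>w T i - v T i\<bar>)
    \<le> exp (c * T) * (Y_norm 1 (w_in - v_in) + \<epsilon> * (\<Sum>i=1..N. real i)
        + (c * \<tau> + A * (\<tau> + \<epsilon> * H) * Y_norm (1 + \<gamma>) w_in) * T)"
proof -
  let ?u = "\<lambda>t i. w t i - v t i" and ?net = "w.net"
  \<comment> \<open>\<open>sqrt (u\<^sup>2 + \<epsilon>\<^sup>2)\<close> is a differentiable substitute for \<open>\<bar>u\<bar>\<close>, and \<open>s\<close> for its sign.\<close>
  define F where "F = (\<lambda>t. \<Sum>i=1..N. real i * sqrt ((?u t i)\<^sup>2 + \<epsilon>\<^sup>2))"
  define s where "s = (\<lambda>t i. ?u t i / sqrt ((?u t i)\<^sup>2 + \<epsilon>\<^sup>2))"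
  have pos: "0 < x\<^sup>2 + \<epsilon>\<^sup>2" for x :: real
    using \<epsilon> by (simp add: sum_power2_gt_zero_iff)
  have abs_le: "\<bar>x\<bar> \<le> sqrt (x\<^sup>2 + \<epsilon>\<^sup>2)" "\<epsilon> \<le> sqrt (x\<^sup>2 + \<epsilon>\<^sup>2)" "sqrt (x\<^sup>2 + \<epsilon>\<^sup>2) \<le> \<bar>x\<bar> + \<epsilon>" for x
    using \<epsilon> sqrt_sum_squares_le_sum_abs[of x \<epsilon>] by (auto intro: real_le_rsqrt)
  have s1: "\<bar>s t i\<bar> \<le> 1" for t i
    using abs_le(1)[of "?u t i"] pos[of "?u t i"] by (simp add: s_def divide_le_eq)
  have s2: "\<bar>?u t i\<bar> - \<epsilon> \<le> s t i * ?u t i" for t i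
  proof -
    \<comment> \<open>Multiplied by \<open>r\<close>, the claim becomes \<open>(\<bar>u\<bar> -
      \<epsilon>) * r \<le> r\<^sup>2 - \<epsilon>\<^sup>2 = u\<^sup>2\<close>, which follows from
      \<open>\<bar>u\<bar> \<le> r\<close> and \<open>\<epsilon> \<le> r\<close>.\<close>
    define r where "r = sqrt ((?u t i)\<^sup>2 + \<epsilon>\<^sup>2)"
    have r: "0 < r" "r\<^sup>2 = (?u t i)\<^sup>2 + \<epsilon>\<^sup>2" "\<epsilon> \<le> r" "\<bar>?u t i\<bar> \<le> r"
      using pos[of "?u t i"] abs_le[of "?u t i"] by (auto simp: r_def)
    have "\<epsilon>\<^sup>2 \<le> \<epsilon> * r"
      using \<epsilon> r by (simp add: power2_eq_square)
    moreover have "\<bar>?u t i\<bar> * r \<le> r\<^sup>2"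
      using mult_right_mono[OF r(4), of r] r(1) by (simp add: power2_eq_square)
    ultimately have "(\<bar>?u t i\<bar> - \<epsilon>) * r \<le> (?u t i)\<^sup>2"
      using r(2) by (simp add: algebra_simps)
    then have "\<bar>?u t i\<bar> - \<epsilon> \<le> (?u t i)\<^sup>2 / r"
      using r by (simp add: pos_le_divide_eq)
    then show ?thesis
      by (simp add: s_def r_def power2_eq_square)
  qed
  have c0: "0 \<le> c"
    using w.A_pos by (simp add: c_def Y_norm_nonneg)
  have \<tau>0: "0 \<le> \<tau>"
    by (simp add: \<tau>_def Y_norm_nonneg)
  have H0: "0 \<le> H"
    by (simp add: H_def sum_nonneg)
  let ?E = "c * \<tau> + A * (\<tau> + \<epsilon> * H) * Y_norm (1 + \<gamma>) w_in"
  have "F T \<le> exp (c * T) * (F 0 + ?E * T)"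
  proof (rule affine_gronwall[OF c0 _ T])
    show "0 \<le> ?E"
      using c0 \<tau>0 H0 \<epsilon> w.A_pos by (simp add: Y_norm_nonneg)
    show "continuous_on {0..T} F"
      unfolding F_def
      by (intro continuous_intros continuous_on_subset[OF w.w_continuous] continuous_on_subset[OF v.w_continuous]) auto
    fix t :: real assume t: "0 < t" "t < T"
    show "(F has_real_derivative (\<Sum>i=1..N. real i * s t i * (?net (w t) i - ?net (v t) i))) (at t)"
      unfolding F_def
    proof (rule DERIV_sum)
      fix i assume "i \<in> {1..N}"
      then have d: "((\<lambda>t. ?u t i) has_real_derivative ?net (w t) i - ?net (v t) i) (at t)"
        using t by (intro DERIV_diff w.w_has_derivative v.w_has_derivative) auto
      have "((\<lambda>t. (?u t i)\<^sup>2 + \<epsilon>\<^sup>2) has_real_derivative 2 * ?u t i * (?net (w t) i - ?net (v t) i)) (at t)"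
        using DERIV_add[OF DERIV_power[OF d, of 2] DERIV_const[of "\<epsilon>\<^sup>2"]] by (simp add: algebra_simps)
      from DERIV_cmult[OF DERIV_chain2[OF DERIV_real_sqrt[OF pos] this], of "real i"]
      show "((\<lambda>t. real i * sqrt ((?u t i)\<^sup>2 + \<epsilon>\<^sup>2)) has_real_derivative
          real i * s t i * (?net (w t) i - ?net (v t) i)) (at t)"
        by (rule DERIV_cong) (simp only: s_def divide_inverse mult_ac, simp)
    qed
    have t0: "0 \<le> t"
      using t by simp
    have us: "w t - v t \<in> Y_space (1 + \<gamma>)"
      by (intro Y_space_diff w.w_space v.w_space t0)
    have "Y_norm (1 + \<gamma>) (seq_tail N (w t) - seq_tail N (v t))
        \<le> Y_norm (1 + \<gamma>) (seq_tail N (w t)) + Y_norm (1 + \<gamma>) (seq_tail N (v t))"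
      by (intro Y_space_diff w.tail_space v.tail_space t0)
    also have "seq_tail N (w t) - seq_tail N (v t) = seq_tail N (w t - v t)"
      by (auto simp: seq_tail_def fun_eq_iff)
    finally have tail: "Y_norm (1 + \<gamma>) (seq_tail N (w t - v t)) \<le> \<tau>"
      using w.tail_le[OF t0, of N] v.tail_le[OF t0, of N] by (simp add: \<tau>_def)
    \<comment> \<open>The differential inequality has to close in \<open>F\<close>, which sees only
      the first \<open>N\<close> components; \<open>\<tau>\<close> absorbs the rest of the
      norm.\<close>
    have "Y_norm 1 (w t - v t) = (\<Sum>i=1..N. real i * \<bar>?u t i\<bar>) + Y_norm 1 (seq_tail N (w t - v t))"
      using Y_norm_split[OF Y_space_exponent_mono(1)[OF us], of 1 N] w.gamma by simp
    also have "(\<Sum>i=1..N. real i * \<bar>?u t i\<bar>) \<le> F t"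
      unfolding F_def by (intro sum_mono mult_left_mono abs_le) auto
    also have "Y_norm 1 (seq_tail N (w t - v t)) \<le> Y_norm (1 + \<gamma>) (seq_tail N (w t - v t))"
      by (rule Y_space_exponent_mono[OF seq_tail_Y_space(1)[OF us]]) (use w.gamma in simp)
    finally have norm: "Y_norm 1 (w t - v t) \<le> F t + \<tau>"
      using tail by simp
    have "(\<Sum>i=1..N. real i * s t i * (?net (w t) i - ?net (v t) i))
        \<le> 2 * A * Y_norm (1 + \<gamma>) (v t) * Y_norm 1 (w t - v t)
          + A * (Y_norm (1 + \<gamma>) (seq_tail N (w t - v t)) + \<epsilon> * H) * Y_norm (1 + \<gamma>) (w t)"
      unfolding H_def using \<epsilon>
      by (intro w.net_diff_le w.w_pos v.w_pos t0 s1 s2) auto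
    also have "\<dots> \<le> c * (F t + \<tau>) + A * (\<tau> + \<epsilon> * H) * Y_norm (1 + \<gamma>) w_in"
      unfolding c_def
      using w.A_pos norm tail \<epsilon> H0 \<tau>0 w.w_norm_le[OF t0] v.w_norm_le[OF t0]
      by (intro add_mono mult_mono mult_nonneg_nonneg order_refl) (auto simp: Y_norm_nonneg)
    finally show "(\<Sum>i=1..N. real i * s t i * (?net (w t) i - ?net (v t) i)) \<le> c * F t + ?E"
      by (simp add: algebra_simps)
  qed
  moreover have "(\<Sum>i=1..N. real i * \<bar>?u T i\<bar>) \<le> F T"
    unfolding F_def by (intro sum_mono mult_left_mono abs_le) auto
  moreover have "F 0 \<le> Y_norm 1 (w_in - v_in) + \<epsilon> * (\<Sum>i=1..N. real i)"
  proof -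
    have "F 0 \<le> (\<Sum>i=1..N. real i * (\<bar>?u 0 i\<bar> + \<epsilon>))"
      unfolding F_def by (intro sum_mono mult_left_mono abs_le) auto
    also have "\<dots> = (\<Sum>i=1..N. real i powr 1 * \<bar>(w_in - v_in) i\<bar>) + \<epsilon> * (\<Sum>i=1..N. real i)"
      using w.w_0 v.w_0 by (simp add: distrib_left sum.distrib sum_distrib_left mult.commute)
    also have "(\<Sum>i=1..N. real i powr 1 * \<bar>(w_in - v_in) i\<bar>) \<le> Y_norm 1 (w_in - v_in)"
      using w.gamma
      by (intro sum_le_Y_norm Y_space_diff Y_space_exponent_mono(1)[OF w.w_in_space] Y_space_exponent_mono(1)[OF v.w_in_space]) auto
    finally show ?thesis
      by simp
  qed
  ultimately show ?thesis
    by (smt (verit, best) exp_gt_zero mult_left_mono)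
qed

text \<open>The order of the limits matters: first \<open>\<epsilon>\<close> tends to 0 for fixed
  \<open>N\<close>, because the factors of \<open>\<epsilon>\<close> grow with \<open>N\<close>;
  then \<open>N\<close> tends to infinity and the tails vanish.\<close>

lemma distance_le:
  assumes T: "0 \<le> T"
  shows "w T - v T \<in> Y_space 1"
    and "Y_norm 1 (w T - v T) \<le> exp (2 * A * Y_norm (1 + \<gamma>) v_in * T) * Y_norm 1 (w_in - v_in)"
proof -
  let ?c = "2 * A * Y_norm (1 + \<gamma>) v_in" and ?D = "Y_norm 1 (w_in - v_in)" and ?W = "Y_norm (1 + \<gamma>) w_in"
  define \<tau> where "\<tau> = (\<lambda>N. Y_norm (1 + \<gamma>) (seq_tail N w_in) + Y_norm (1 + \<gamma>) (seq_tail N v_in))"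
  have 1: "(\<Sum>i=1..N. real i * \<bar>w T i - v T i\<bar>) \<le> exp (?c * T) * (?D + (?c * \<tau> N + A * \<tau> N * ?W) * T)" for N
  proof (rule tendsto_lowerbound)
    let ?f = "\<lambda>\<epsilon>. exp (?c * T) * (?D + \<epsilon> * (\<Sum>i=1..N. real i)
        + (?c * \<tau> N + A * (\<tau> N + \<epsilon> * (\<Sum>i=1..N. real i powr (1 + \<gamma>))) * ?W) * T)"
    show "(?f \<longlongrightarrow> exp (?c * T) * (?D + (?c * \<tau> N + A * \<tau> N * ?W) * T)) (at_right 0)"
      by (auto intro!: tendsto_eq_intros)
    show "\<forall>\<^sub>F \<epsilon> in at_right 0. (\<Sum>i=1..N. real i * \<bar>w T i - v T i\<bar>) \<le> ?f \<epsilon>"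
      using eventually_at_right_less[of 0]
      by eventually_elim (use smoothed_distance_le[OF _ T] in \<open>simp add: \<tau>_def\<close>)
  qed auto
  have "\<tau> \<longlonglongrightarrow> 0 + 0"
    unfolding \<tau>_def by (intro tendsto_add seq_tail_tendsto_0 w.w_in_space v.w_in_space)
  then have lim: "(\<lambda>N. exp (?c * T) * (?D + (?c * \<tau> N + A * \<tau> N * ?W) * T)) \<longlonglongrightarrow> exp (?c * T) * ?D"
    by (auto intro!: tendsto_eq_intros)
  have "(\<Sum>i=1..n. real i powr 1 * \<bar>(w T - v T) i\<bar>) \<le> exp (?c * T) * ?D" for n
  proof (rule LIMSEQ_le_const[OF lim], intro exI allI impI)
    fix N assume "n \<le> N"
    then have "(\<Sum>i=1..n. real i powr 1 * \<bar>(w T - v T) i\<bar>) \<le> (\<Sum>i=1..N. real i * \<bar>w T i - v T i\<bar>)"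
      by (simp, intro sum_mono2) auto
    with 1[of N] show "(\<Sum>i=1..n. real i powr 1 * \<bar>(w T - v T) i\<bar>)
        \<le> exp (?c * T) * (?D + (?c * \<tau> N + A * \<tau> N * ?W) * T)"
      by simp
  qed
  then show "w T - v T \<in> Y_space 1" "Y_norm 1 (w T - v T) \<le> exp (?c * T) * ?D"
    by (auto intro!: Y_space_bounded_sums)
qed

end

theorem proposition3p2:
  fixes a :: "nat \<Rightarrow> nat \<Rightarrow> real" and b :: "nat \<Rightarrow> nat \<Rightarrow> nat \<Rightarrow> real"
    and \<gamma> A \<beta>0 \<beta>1 :: real
  assumes a_sym: "\<And>i j. 1 \<le> i \<Longrightarrow> 1 \<le> j \<Longrightarrow> a i j = a j i"
    and a_nonneg: "\<And>i j. 1 \<le> i \<Longrightarrow> 1 \<le> j \<Longrightarrow> 0 \<le> a i j"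
    and gamma: "0 \<le> \<gamma>" "\<gamma> \<le> 1"
    and A_pos: "0 < A"
    and a_bound: "\<And>i j. 1 \<le> i \<Longrightarrow> 1 \<le> j \<Longrightarrow> a i j \<le> A * (real i * real j) powr \<gamma>"
    and b_nonneg: "\<And>i j k. 1 \<le> i \<Longrightarrow> i \<le> j - 1 \<Longrightarrow> 2 \<le> j \<Longrightarrow> 1 \<le> k \<Longrightarrow> 0 \<le> b i j k"
    and b_mass: "\<And>j k. 2 \<le> j \<Longrightarrow> 1 \<le> k \<Longrightarrow> (\<Sum>i=1..j-1. real i * b i j k) = real j"
    and beta: "0 \<le> \<beta>0" "0 \<le> \<beta>1"
    and b_bound: "\<And>s i j. 1 \<le> s \<Longrightarrow> s \<le> i - 1 \<Longrightarrow> i \<le> j \<Longrightarrow> b s i j \<le> \<beta>0 + \<beta>1 * b s j i"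
  shows "\<exists>\<kappa> :: real \<Rightarrow> real \<Rightarrow> real \<Rightarrow> real.
    \<forall>w_in v_in w v.
      w_in \<in> Y_pos (1 + \<gamma>) \<and> v_in \<in> Y_pos (1 + \<gamma>) \<and>
      cib_solution a b \<infinity> w_in w \<and> cib_solution a b \<infinity> v_in v \<and>
      (\<forall>T>0. Linf_Y_pos (1 + \<gamma>) {0<..<T} w) \<and> (\<forall>T>0. Linf_Y_pos (1 + \<gamma>) {0<..<T} v) \<longrightarrow>
      (\<forall>T\<ge>0.
        0 < \<kappa> T (Y_norm (1 + \<gamma>) w_in) (Y_norm (1 + \<gamma>) v_in) \<and>
        (\<forall>t\<in>{0..T}. w t - v t \<in> Y_space 1) \<and>
        bdd_above ((\<lambda>t. Y_norm 1 (w t - v t)) ` {0..T}) \<and>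
        (SUP t\<in>{0..T}. Y_norm 1 (w t - v t))
          \<le> \<kappa> T (Y_norm (1 + \<gamma>) w_in) (Y_norm (1 + \<gamma>) v_in) * Y_norm 1 (w_in - v_in))"
\<comment> \<open>The rate \<open>2 * A * y\<close>, with \<open>y\<close> the norm of the second
  initial datum, is the constant of the Gronwall estimate.\<close>
proof (intro exI[of _ "\<lambda>T x y. exp (2 * A * y * T)"] allI impI, elim conjE, intro conjI ballI)
  fix w_in v_in w v and T :: real
  assume w: "w_in \<in> Y_pos (1 + \<gamma>)" "cib_solution a b \<infinity> w_in w" "\<forall>T>0. Linf_Y_pos (1 + \<gamma>) {0<..<T} w"
    and v: "v_in \<in> Y_pos (1 + \<gamma>)" "cib_solution a b \<infinity> v_in v" "\<forall>T>0. Linf_Y_pos (1 + \<gamma>) {0<..<T} v"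
    and T: "0 \<le> T"
  interpret breakage_solution_pair a b \<gamma> A w_in w v_in v
    by unfold_locales (use assms w v in auto)
  let ?K = "exp (2 * A * Y_norm (1 + \<gamma>) v_in * T) * Y_norm 1 (w_in - v_in)"
  show "0 < exp (2 * A * Y_norm (1 + \<gamma>) v_in * T)"
    by simp
  show "w t - v t \<in> Y_space 1" if "t \<in> {0..T}" for t
    using distance_le(1) that by simp
  have le: "Y_norm 1 (w t - v t) \<le> ?K" if t: "t \<in> {0..T}" for t
  proof -
    have "Y_norm 1 (w t - v t) \<le> exp (2 * A * Y_norm (1 + \<gamma>) v_in * t) * Y_norm 1 (w_in - v_in)"
      using t by (intro distance_le) auto
    \<comment> \<open>The exponential is nondecreasing in time, so its value at \<open>T\<close>
      serves the whole interval.\<close>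
    also have "\<dots> \<le> ?K"
      using t A_pos by (intro mult_right_mono iffD2[OF exp_le_cancel_iff] mult_left_mono) (auto simp: Y_norm_nonneg)
    finally show ?thesis .
  qed
  then show "bdd_above ((\<lambda>t. Y_norm 1 (w t - v t)) ` {0..T})"
    by (rule bdd_aboveI2)
  show "(SUP t\<in>{0..T}. Y_norm 1 (w t - v t)) \<le> ?K"
    using T le by (intro cSUP_least) auto
qed

end
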